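(* Let $X$ be a Polish space, let $d$ be a bounded lower semi-continuous metric on $X$, and let $\Delta=\sup_{x,y}d(x,y)$ be the $d$-diameter of $X$, with $\Delta>0$. Let $\mu_1,\mu_2$ be two Borel probability measures on $X$. Then, for every $0\le\varrho<1$, there exist $\delta\ge0$ and a $(\varrho\Delta,\delta)$-Lipschitz classifier $c_f$ (with respect to $d,\mu_1,\mu_2$) such that $$\delta\ \le\ \frac{2}{1-\varrho}\left(1-\frac{W_X(\mu_1,\mu_2)}{\Delta}\right).$$
   Context: A lower semi-continuous metric on a Polish space $X$ is a metric $d:X\times X\to[0,\infty)$ that is lower semi-continuous for the product of the Polish topology; it need not induce the topology of $X$. Lipschitz is always with respect to $d$; measurable means Borel measurable for the Polish topology. For Borel probability measures, $W_X(\mu_1,\mu_2)=\inf_{\vartheta}\int_{X\times X} d(x,y)\,d\vartheta(x,y)$, the infimum being over all couplings $\vartheta$ of $\mu_1$ and $\mu_2$ (Borel probability measures on $X\times X$ with marginals $\mu_1,\mu_2$). For a measurable $f:X\to\mathbb R$, the associated binary classifier is $c_f=\mathbf 1_{\{f>0\}}-\mathbf 1_{\{f\le 0\}}$, and $f$ is called its classification function. For $\epsilon\ge0$ put $$\varepsilon(c_f,\epsilon;\mu_i,\mu_j)=\mu_i(\{x: f(x)\le \epsilon/2\})+\mu_j(\{x: f(x)>-\epsilon/2\}),$$ $$\mathrm{err}(f,\epsilon;\mu_1,\mu_2)=\min\big(\varepsilon(c_f,\epsilon;\mu_1,\mu_2),\ \varepsilon(c_f,\epsilon;\mu_2,\mu_1)\big).$$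 The classifier $c_f$ is an $(\epsilon,\delta)$-Lipschitz classifier if $f$ is measurable, $f\in L_1(\mu_1)\cap L_1(\mu_2)$, $f$ is 1-Lipschitz with respect to $d$, and $\mathrm{err}(f,\epsilon;\mu_1,\mu_2)\le\delta$. *)

theory Defs
  imports "HOL-Probability.Probability"
begin

text \<open>
  The Polish topology of \<open>X\<close> is that of the type class \<open>polish_space\<close>. Its complete metric
  \<open>dist\<close> only serves to exhibit that topology; the metric \<open>d\<close> below is a separate function and
  may induce a different topology.
\<close>

definition lower_semicont :: "('b::topological_space \<Rightarrow> real) \<Rightarrow> bool" where
  "lower_semicont g \<longleftrightarrow> (\<forall>c. open {z. c < g z})"

definition lsc_metric :: "('a::polish_space \<Rightarrow> 'a \<Rightarrow> real) \<Rightarrow> bool" where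
  "lsc_metric d \<longleftrightarrow> Metric_space UNIV d \<and> lower_semicont (\<lambda>(x, y). d x y)"

text \<open>A real supremum, hence meaningful only when \<open>d\<close> is bounded.\<close>

definition diam :: "('a \<Rightarrow> 'a \<Rightarrow> real) \<Rightarrow> real" where
  "diam d = (SUP (x, y). d x y)"

definition borel_prob :: "'b::topological_space measure \<Rightarrow> bool" where
  "borel_prob M \<longleftrightarrow> prob_space M \<and> sets M = sets borel"

text \<open>
  The Borel sets of the product topology coincide here with the product \<open>\<sigma>\<close>-algebra
  (\<open>borel_prod\<close>), since a Polish space is second countable.
\<close>

definition couplings ::
    "'a::polish_space measure \<Rightarrow> 'a measure \<Rightarrow> ('a \<times> 'a) measure set" where
  "couplings \<mu>1 \<mu>2 = {\<theta>. borel_prob \<theta> \<and> distr \<theta> borel fst = \<mu>1 \<and> distr \<theta> borel snd = \<mu>2}"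

text \<open>
  Valued in \<open>[0,\<infinity>]\<close>, so that no integrability is needed for the definition to be meaningful.
\<close>

definition wasserstein ::
    "('a::polish_space \<Rightarrow> 'a \<Rightarrow> real) \<Rightarrow> 'a measure \<Rightarrow> 'a measure \<Rightarrow> ennreal" where
  "wasserstein d \<mu>1 \<mu>2 =
     (INF \<theta>\<in>couplings \<mu>1 \<mu>2. \<integral>\<^sup>+ (x, y). ennreal (d x y) \<partial>\<theta>)"

definition classifier :: "('a \<Rightarrow> real) \<Rightarrow> 'a \<Rightarrow> real" where
  "classifier f = (\<lambda>x. indicator {x. f x > 0} x - indicator {x. f x \<le> 0} x)"

text \<open>The error depends on \<open>f\<close> itself and not only on the classifier \<open>classifier f\<close>.\<close>

definition margin_error ::
    "('a \<Rightarrow> real) \<Rightarrow> real \<Rightarrow> 'a measure \<Rightarrow> 'a measure \<Rightarrow> real" where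
  "margin_error f \<epsilon> \<mu> \<nu> = measure \<mu> {x. f x \<le> \<epsilon> / 2} + measure \<nu> {x. f x > - \<epsilon> / 2}"

definition err ::
    "('a \<Rightarrow> real) \<Rightarrow> real \<Rightarrow> 'a measure \<Rightarrow> 'a measure \<Rightarrow> real" where
  "err f \<epsilon> \<mu>1 \<mu>2 = min (margin_error f \<epsilon> \<mu>1 \<mu>2) (margin_error f \<epsilon> \<mu>2 \<mu>1)"

text \<open>
  \<open>c\<close> is an \<open>(\<epsilon>, \<delta>)\<close>-Lipschitz classifier with classification function \<open>f\<close>.
\<close>

definition lipschitz_classifier ::
    "('a::polish_space \<Rightarrow> 'a \<Rightarrow> real) \<Rightarrow> 'a measure \<Rightarrow> 'a measure \<Rightarrow> real \<Rightarrow> real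
      \<Rightarrow> ('a \<Rightarrow> real) \<Rightarrow> ('a \<Rightarrow> real) \<Rightarrow> bool" where
  "lipschitz_classifier d \<mu>1 \<mu>2 \<epsilon> \<delta> c f \<longleftrightarrow>
     c = classifier f \<and>
     f \<in> borel_measurable borel \<and>
     integrable \<mu>1 f \<and> integrable \<mu>2 f \<and>
     (\<forall>x y. \<bar>f x - f y\<bar> \<le> d x y) \<and>
     err f \<epsilon> \<mu>1 \<mu>2 \<le> \<delta>"

text \<open>For bounded \<open>d\<close> the Wasserstein distance is finite, so \<open>enn2real\<close> returns its true value.\<close>

lemma wasserstein_le_diam:
  fixes d :: "'a::polish_space \<Rightarrow> 'a \<Rightarrow> real"
  assumes d: "lsc_metric d" "Metric_space.mbounded UNIV d UNIV"
    and \<mu>: "borel_prob \<mu>1" "borel_prob \<mu>2"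
  shows "wasserstein d \<mu>1 \<mu>2 \<le> ennreal (diam d)"
proof -
  interpret m: Metric_space UNIV d using d(1) by (simp add: lsc_metric_def)
  obtain B where B: "\<And>x y. d x y \<le> B" using d(2) by (auto simp: m.mbounded_alt)
  have le: "d x y \<le> diam d" for x y
  proof -
    have "bdd_above (range (\<lambda>(x, y). d x y))" using B by (auto intro!: bdd_aboveI[of _ B])
    from cSUP_upper[OF _ this, of "(x, y)"] show ?thesis by (simp add: diam_def)
  qed
  interpret p1: prob_space \<mu>1 using \<mu> by (simp add: borel_prob_def)
  interpret p2: prob_space \<mu>2 using \<mu> by (simp add: borel_prob_def)
  interpret pp: pair_prob_space \<mu>1 \<mu>2 ..
  have s: "sets \<mu>1 = sets borel" "sets \<mu>2 = sets borel" using \<mu> by (auto simp: borel_prob_def)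
  let ?P = "\<mu>1 \<Otimes>\<^sub>M \<mu>2"
  have sP: "sets ?P = sets borel"
    unfolding sets_pair_measure_cong[OF s] borel_prod ..
  have 1: "distr ?P borel fst = \<mu>1"
  proof -
    have "distr ?P borel fst = distr ?P \<mu>1 fst" by (rule distr_cong) (auto simp: s)
    then show ?thesis using p2.distr_pair_fst[of \<mu>1] by simp
  qed
  have 2: "distr ?P borel snd = \<mu>2"
  proof (rule measure_eqI)
    show "sets (distr ?P borel snd) = sets \<mu>2" by (simp add: s)
    fix A assume "A \<in> sets (distr ?P borel snd)"
    then have A: "A \<in> sets \<mu>2" by (simp add: s)
    have sp: "space \<mu>1 = UNIV" "space \<mu>2 = UNIV"
      using s[THEN sets_eq_imp_space_eq] by auto
    have m: "snd \<in> measurable ?P borel"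
      using measurable_cong_sets[OF refl s(2)] measurable_snd by blast
    have "emeasure (distr ?P borel snd) A = emeasure ?P (space \<mu>1 \<times> A)"
      using A m by (subst emeasure_distr) (auto simp: s space_pair_measure sp intro!: arg_cong[where f="emeasure ?P"])
    also have "\<dots> = emeasure \<mu>2 A"
      using A by (subst p2.emeasure_pair_measure_Times) (auto simp: p1.emeasure_space_1)
    finally show "emeasure (distr ?P borel snd) A = emeasure \<mu>2 A" .
  qed
  have "?P \<in> couplings \<mu>1 \<mu>2"
    using 1 2 sP pp.prob_space_axioms by (simp add: couplings_def borel_prob_def)
  then have "wasserstein d \<mu>1 \<mu>2 \<le> (\<integral>\<^sup>+ (x, y). ennreal (d x y) \<partial>?P)"
    unfolding wasserstein_def by (rule INF_lower)
  also have "\<dots> \<le> (\<integral>\<^sup>+ z. ennreal (diam d) \<partial>?P)"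
    by (rule nn_integral_mono) (auto simp: le intro!: ennreal_leI)
  also have "\<dots> = ennreal (diam d)" by (simp add: pp.emeasure_space_1)
  finally show ?thesis .
qed

end

theory Submission
  imports Defs
begin

text \<open>
  Let \<open>\<Delta>\<close> be the diameter and \<open>W\<close> the transport distance. A good classification function is the
  distance to a set \<open>D\<close> that carries most of \<open>\<mu>2\<close>, shifted by half a margin: it classifies correctly on
  \<open>D\<close> and on every set \<open>A\<close> all of whose points are far from \<open>D\<close>. So the error is at most
  \<open>2 - \<mu>1(A) - \<mu>2(D)\<close>, and everything reduces to finding far apart sets \<open>A\<close> and \<open>D\<close> of almost full
  measure (\<open>classifier_of_separated_sets\<close>).

  Such sets exist by a theorem of Strassen: for an open set \<open>U\<close> of pairs, if every Borel rectangle
  \<open>A \<times> D \<subseteq> U\<close> satisfies \<open>\<mu>1(A) + \<mu>2(D) \<le> 1 + s\<close>, then some coupling gives \<open>U\<close> mass at most \<open>s\<close>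
  (\<open>strassen_open_set\<close>). Take for \<open>U\<close> the pairs at distance more than \<open>\<kappa>\<Delta>\<close>, which is open because \<open>d\<close>
  is lower semi-continuous. A coupling with \<open>\<theta>(U) \<le> 1 - b\<close> costs at most
  \<open>\<kappa>\<Delta> + (1 - \<kappa>)\<Delta>(1 - b)\<close>, which is less than \<open>W\<close> as soon as \<open>(1 - \<kappa>)b > 1 - W/\<Delta>\<close>. Hence for
  these \<open>b\<close> there are compact sets more than \<open>\<kappa>\<Delta>\<close> apart whose measures add up to at least \<open>2 - b\<close>
  (\<open>exists_far_compacts\<close>).

  This argument with \<open>0/1\<close> costs loses only a factor close to \<open>1\<close>, whereas the claimed bound allows a
  factor \<open>2\<close>. If \<open>W < \<Delta>\<close>, that room absorbs both the strict inequality for \<open>b\<close> and a choice of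
  \<open>\<kappa>\<close> slightly above \<open>\<rho>\<close>. If \<open>W = \<Delta>\<close>, the bound is \<open>0\<close>; then \<open>b\<close> may be taken to be \<open>2\<^sup>-\<^sup>n\<close> for
  every \<open>n\<close>, and by Borel-Cantelli the points that lie in all but finitely many of the compact sets
  have full measure and are still \<open>\<kappa>\<Delta>\<close> apart.

  Strassen's theorem is first proved for finite sets, as a max-flow min-cut statement
  (\<open>finite_strassen\<close>). Applied to the partitions generated by finitely many basic balls it yields
  couplings that are good for larger and larger parts of \<open>U\<close>; a limit of them is good for \<open>U\<close>.
  The limit exists because couplings are sequentially compact (\<open>couplings_limit\<close>): a point is encoded
  by the sequence of bits telling in which basic balls it lies, the finite-dimensional laws of the bits
  converge along a subsequence, a random bit sequence with the limit laws is constructed on the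
  unit interval, and it is decoded again. No mass escapes in the limit since both marginals are fixed.
\<close>

section \<open>Strassen's theorem on finite sets\<close>

text \<open>
  The upper bound \<open>1\<close> on all entries, also those outside \<open>I \<times> J\<close>, serves only to place the set of
  subtransports in a compact product of intervals.
\<close>

lemma exists_maximal_subtransport:
  fixes p :: "'i \<Rightarrow> real" and r :: "'j \<Rightarrow> real" and V :: "'i \<Rightarrow> 'j \<Rightarrow> bool"
  assumes "\<And>i. i \<in> I \<Longrightarrow> 0 \<le> p i" "\<And>j. j \<in> J \<Longrightarrow> 0 \<le> r j"
  defines "F \<equiv> {w. (\<forall>x. 0 \<le> w x \<and> w x \<le> 1) \<and> (\<forall>i\<in>I. (\<Sum>j\<in>J. w (i, j)) \<le> p i) \<and>
      (\<forall>j\<in>J. (\<Sum>i\<in>I. w (i, j)) \<le> r j) \<and> (\<forall>i\<in>I. \<forall>j\<in>J. V i j \<longrightarrow> w (i, j) = 0)}"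
  shows "\<exists>w\<in>F. \<forall>w'\<in>F. (\<Sum>i\<in>I. \<Sum>j\<in>J. w' (i, j)) \<le> (\<Sum>i\<in>I. \<Sum>j\<in>J. w (i, j))"
proof -
  have coord: "continuous_on UNIV (\<lambda>w::'i \<times> 'j \<Rightarrow> real. w x)" for x
    by simp
  have "compactin euclidean (Pi\<^sub>E UNIV (\<lambda>_::'i \<times> 'j. {0..1::real}))"
    unfolding euclidean_product_topology[symmetric] compactin_PiE by auto
  then have "compact (Pi\<^sub>E UNIV (\<lambda>_::'i \<times> 'j. {0..1::real}))"
    by simp
  moreover have "closed {w::'i \<times> 'j \<Rightarrow> real. (\<forall>i\<in>I. (\<Sum>j\<in>J. w (i, j)) \<le> p i) \<and>
      (\<forall>j\<in>J. (\<Sum>i\<in>I. w (i, j)) \<le> r j) \<and> (\<forall>i\<in>I. \<forall>j\<in>J. V i j \<longrightarrow> w (i, j) = 0)}"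
    unfolding Ball_def
    by (intro closed_Collect_conj closed_Collect_all closed_Collect_imp closed_Collect_le
        closed_Collect_eq continuous_intros coord open_Collect_const)
  ultimately have "compact (Pi\<^sub>E UNIV (\<lambda>_::'i \<times> 'j. {0..1::real}) \<inter>
      {w. (\<forall>i\<in>I. (\<Sum>j\<in>J. w (i, j)) \<le> p i) \<and>
      (\<forall>j\<in>J. (\<Sum>i\<in>I. w (i, j)) \<le> r j) \<and> (\<forall>i\<in>I. \<forall>j\<in>J. V i j \<longrightarrow> w (i, j) = 0)})"
    by (rule compact_Int_closed)
  moreover have "Pi\<^sub>E UNIV (\<lambda>_::'i \<times> 'j. {0..1::real}) \<inter>
      {w. (\<forall>i\<in>I. (\<Sum>j\<in>J. w (i, j)) \<le> p i) \<and>
      (\<forall>j\<in>J. (\<Sum>i\<in>I. w (i, j)) \<le> r j) \<and> (\<forall>i\<in>I. \<forall>j\<in>J. V i j \<longrightarrow> w (i, j) = 0)} = F"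
    by (auto simp: F_def PiE_iff)
  ultimately have "compact F" by simp
  moreover have "(\<lambda>_. 0) \<in> F" using assms(1,2) by (auto simp: F_def)
  moreover have "continuous_on F (\<lambda>w. \<Sum>i\<in>I. \<Sum>j\<in>J. w (i, j))"
    by (intro continuous_intros continuous_on_subset[OF coord]) auto
  ultimately show ?thesis
    using continuous_attains_sup[of F "\<lambda>w. \<Sum>i\<in>I. \<Sum>j\<in>J. w (i, j)"] by (metis empty_iff)
qed

text \<open>
  A weighted form of Hall's theorem. Choose a subtransport of maximal total mass that avoids \<open>V\<close>, and
  among those one for which the number of rows that are not exhausted is maximal. Let \<open>A\<close> be the set of
  these rows and \<open>C\<close> the columns that some row of \<open>A\<close> may use. Maximality of the mass forces the columns
  in \<open>C\<close> to be exhausted. Maximality of the number of rows forces their mass to come from \<open>A\<close>, since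
  rerouting a little mass from a row outside \<open>A\<close> would free that row; this replaces the search for
  augmenting paths. So \<open>A\<close> and the columns outside \<open>C\<close> span a rectangle inside \<open>V\<close> that bounds the mass
  still to be placed, and this mass is spread as a product over the remaining capacities.
\<close>

lemma finite_strassen:
  fixes p :: "'i \<Rightarrow> real" and r :: "'j \<Rightarrow> real" and V :: "'i \<Rightarrow> 'j \<Rightarrow> bool"
  assumes fin: "finite I" "finite J"
    and p: "\<And>i. i \<in> I \<Longrightarrow> 0 \<le> p i" "sum p I = 1"
    and r: "\<And>j. j \<in> J \<Longrightarrow> 0 \<le> r j" "sum r J = 1"
    and V: "\<And>A D. A \<subseteq> I \<Longrightarrow> D \<subseteq> J \<Longrightarrow> (\<And>i j. i \<in> A \<Longrightarrow> j \<in> D \<Longrightarrow> V i j) \<Longrightarrow>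
      sum p A + sum r D \<le> 1 + s"
  shows "\<exists>w. (\<forall>i\<in>I. \<forall>j\<in>J. 0 \<le> w i j) \<and> (\<forall>i\<in>I. (\<Sum>j\<in>J. w i j) = p i) \<and>
    (\<forall>j\<in>J. (\<Sum>i\<in>I. w i j) = r j) \<and> (\<Sum>i\<in>I. \<Sum>j\<in>J. if V i j then w i j else 0) \<le> s"
proof -
  define F where "F = {w. (\<forall>x. 0 \<le> w x \<and> w x \<le> (1::real)) \<and>
      (\<forall>i\<in>I. (\<Sum>j\<in>J. w (i, j)) \<le> p i) \<and>
      (\<forall>j\<in>J. (\<Sum>i\<in>I. w (i, j)) \<le> r j) \<and> (\<forall>i\<in>I. \<forall>j\<in>J. V i j \<longrightarrow> w (i, j) = 0)}"
  define T where "T w = (\<Sum>i\<in>I. \<Sum>j\<in>J. w (i, j))" for w :: "'i \<times> 'j \<Rightarrow> real"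
  define slack where "slack w = {i\<in>I. (\<Sum>j\<in>J. w (i, j)) < p i}" for w :: "'i \<times> 'j \<Rightarrow> real"
  have "\<exists>w\<in>F. \<forall>w'\<in>F. T w' \<le> T w"
    unfolding F_def T_def by (rule exists_maximal_subtransport[OF p(1) r(1)])
  then obtain w0 where w0: "w0 \<in> F" "\<And>w. w \<in> F \<Longrightarrow> T w \<le> T w0" by blast
  have "\<exists>w. (w \<in> F \<and> T w = T w0) \<and> (\<forall>w'. w' \<in> F \<and> T w' = T w0 \<longrightarrow> card (slack w') \<le> card (slack w))"
    using w0(1) fin(1)
    by (intro ex_has_greatest_nat[of _ w0 _ "Suc (card I)"])
      (auto simp: slack_def less_Suc_eq_le intro!: card_mono)
  then obtain w where w: "w \<in> F" and Tw: "T w = T w0"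
    and most: "\<And>w'. w' \<in> F \<Longrightarrow> T w' = T w0 \<Longrightarrow> card (slack w') \<le> card (slack w)" by blast
  have max: "T w' \<le> T w" if "w' \<in> F" for w' using w0(2)[OF that] Tw by simp
  have wn: "0 \<le> w x" and w1: "w x \<le> 1" for x using w unfolding F_def by blast+
  have row: "(\<Sum>j\<in>J. w (i, j)) \<le> p i" if "i \<in> I" for i using w that by (auto simp: F_def)
  have col: "(\<Sum>i\<in>I. w (i, j)) \<le> r j" if "j \<in> J" for j using w that by (auto simp: F_def)
  have V0: "w (i, j) = 0" if "i \<in> I" "j \<in> J" "V i j" for i j using w that by (auto simp: F_def)
  have p1: "p i \<le> 1" if "i \<in> I" for i
    using member_le_sum[of i I p] that p fin(1) by auto
  define A where "A = slack w"
  define C where "C = {j\<in>J. \<exists>i\<in>A. \<not> V i j}"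
  have AI: "A \<subseteq> I" and CJ: "C \<subseteq> J" by (auto simp: A_def C_def slack_def)
  have entry_le: "v (i, j) \<le> (\<Sum>j\<in>J. v (i, j))"
    if "i \<in> I" "j \<in> J" "\<And>x. 0 \<le> v x" for i j and v :: "'i \<times> 'j \<Rightarrow> real"
    using member_le_sum[of j J "\<lambda>j. v (i, j)"] that fin(2) by auto
  have rowb: "(\<Sum>j'\<in>J. of_bool ((i', j') = (i, j))) = (of_bool (i' = i) :: real)"
    if "j \<in> J" for i i' j using that fin(2) by (cases "i' = i") (auto simp: of_bool_def)
  have colb: "(\<Sum>i'\<in>I. of_bool ((i', j') = (i, j))) = (of_bool (j' = j) :: real)"
    if "i \<in> I" for i j j' using that fin(1) by (cases "j' = j") (auto simp: of_bool_def)
  \<comment> \<open>Otherwise mass could be added in this column, in a row that has some to spare.\<close>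
  have sat_col: "(\<Sum>i\<in>I. w (i, j)) = r j" if "j \<in> C" for j
  proof (rule ccontr)
    assume "(\<Sum>i\<in>I. w (i, j)) \<noteq> r j"
    then have gap: "(\<Sum>i\<in>I. w (i, j)) < r j" using col that CJ by force
    obtain i where i: "i \<in> A" "\<not> V i j" using \<open>j \<in> C\<close> by (auto simp: C_def)
    have iI: "i \<in> I" and jJ: "j \<in> J" using i AI that CJ by auto
    have gap': "(\<Sum>j\<in>J. w (i, j)) < p i" using i by (auto simp: A_def slack_def)
    define e where "e = min (p i - (\<Sum>j\<in>J. w (i, j))) (r j - (\<Sum>i\<in>I. w (i, j)))"
    have e: "0 < e" "(\<Sum>j\<in>J. w (i, j)) + e \<le> p i" "(\<Sum>i\<in>I. w (i, j)) + e \<le> r j"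
      using gap gap' by (auto simp: e_def)
    define w' where "w' x = w x + e * of_bool (x = (i, j))" for x
    have rw: "(\<Sum>j'\<in>J. w' (i', j')) = (\<Sum>j'\<in>J. w (i', j')) + e * of_bool (i' = i)" for i'
      unfolding w'_def sum.distrib sum_distrib_left[symmetric] rowb[OF jJ] ..
    have cl: "(\<Sum>i'\<in>I. w' (i', j')) = (\<Sum>i'\<in>I. w (i', j')) + e * of_bool (j' = j)" for j'
      unfolding w'_def sum.distrib sum_distrib_left[symmetric] colb[OF iI] ..
    have nn: "0 \<le> w' x" for x using wn[of x] e(1) by (auto simp: w'_def)
    have r': "(\<Sum>j'\<in>J. w' (i', j')) \<le> p i'" if "i' \<in> I" for i'
      using row[OF that] e(2) unfolding rw by (cases "i' = i") auto
    have "w' x \<le> 1" for x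
      using entry_le[OF iI jJ, of w'] nn r'[OF iI] p1[OF iI] w1[of x]
      by (cases "x = (i, j)") (auto simp: w'_def)
    moreover have "(\<Sum>i'\<in>I. w' (i', j')) \<le> r j'" if "j' \<in> J" for j'
      using col[OF that] e(3) unfolding cl by (cases "j' = j") auto
    moreover have "w' (i', j') = 0" if "i' \<in> I" "j' \<in> J" "V i' j'" for i' j'
      using V0[OF that] i(2) that(3) by (auto simp: w'_def)
    ultimately have "w' \<in> F"
      using nn r' unfolding F_def by blast
    moreover have "T w' = T w + e"
      unfolding T_def rw sum.distrib sum_distrib_left[symmetric]
      using iI fin(1) by (simp add: of_bool_def)
    ultimately show False using max e(1) by force
  qed
  \<comment> \<open>Otherwise a little mass could be rerouted from row \<open>i\<close> to a row of \<open>A\<close>, which would free row \<open>i\<close>.\<close>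
  have closed: "w (i, j) = 0" if ij: "i \<in> I - A" "j \<in> C" for i j
  proof (rule ccontr)
    assume "w (i, j) \<noteq> 0"
    then have pos: "0 < w (i, j)" using wn[of "(i, j)"] by simp
    obtain i0 where i0: "i0 \<in> A" "\<not> V i0 j" using ij by (auto simp: C_def)
    have iI: "i \<in> I" "i0 \<in> I" and jJ: "j \<in> J" and ne: "i0 \<noteq> i" using i0 AI ij CJ by auto
    have gap: "(\<Sum>j\<in>J. w (i0, j)) < p i0" using i0 by (auto simp: A_def slack_def)
    define e where "e = min (w (i, j)) ((p i0 - (\<Sum>j\<in>J. w (i0, j))) / 2)"
    have e: "0 < e" "e \<le> w (i, j)" "(\<Sum>j\<in>J. w (i0, j)) + e < p i0"
      using gap pos by (auto simp: e_def min_def field_simps)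
    define w' where "w' x = w x + e * of_bool (x = (i0, j)) + (- e) * of_bool (x = (i, j))" for x
    have rw: "(\<Sum>j'\<in>J. w' (i', j')) =
        (\<Sum>j'\<in>J. w (i', j')) + e * of_bool (i' = i0) + (- e) * of_bool (i' = i)" for i'
      unfolding w'_def sum.distrib sum_distrib_left[symmetric] rowb[OF jJ] ..
    have cl: "(\<Sum>i'\<in>I. w' (i', j')) = (\<Sum>i'\<in>I. w (i', j'))" for j'
      unfolding w'_def sum.distrib sum_distrib_left[symmetric] colb[OF iI(1)] colb[OF iI(2)] by simp
    have nn: "0 \<le> w' x" for x using wn[of x] e(1,2) by (auto simp: w'_def)
    have r': "(\<Sum>j'\<in>J. w' (i', j')) \<le> p i'" if "i' \<in> I" for i'
      using row[OF that] e(1,3) unfolding rw by (auto simp: of_bool_def)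
    have "w' x \<le> 1" for x
      using entry_le[OF iI(2) jJ, of w'] nn r'[OF iI(2)] p1[OF iI(2)] w1[of x] e(1)
      by (cases "x = (i0, j)") (auto simp: w'_def)
    moreover have "w' (i', j') = 0" if "i' \<in> I" "j' \<in> J" "V i' j'" for i' j'
      using V0[OF that] V0[OF iI(1) jJ] i0(2) that(3) pos by (auto simp: w'_def)
    moreover have "(\<Sum>i'\<in>I. w' (i', j')) \<le> r j'" if "j' \<in> J" for j'
      using col[OF that] unfolding cl .
    ultimately have "w' \<in> F"
      using nn r' unfolding F_def by blast
    moreover have "T w' = T w"
      unfolding T_def rw sum.distrib sum_distrib_left[symmetric]
      using iI fin(1) by (simp add: of_bool_def)
    moreover have "insert i A \<subseteq> slack w'"
      using e iI row[OF iI(1)] AI unfolding slack_def rw A_def by (auto simp: of_bool_def)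
    then have "card (insert i A) \<le> card (slack w')"
      using fin(1) by (intro card_mono) (auto simp: slack_def)
    moreover have "card (insert i A) = Suc (card A)"
      using ij finite_subset[OF AI fin(1)] by auto
    ultimately show False using most[of w'] Tw by (simp add: A_def)
  qed
  define D where "D = J - C"
  have DJ: "D \<subseteq> J" by (auto simp: D_def)
  have AD: "V i j" if "i \<in> A" "j \<in> D" for i j using that by (auto simp: C_def D_def)
  have "(\<Sum>i\<in>A. \<Sum>j\<in>J. w (i, j)) = (\<Sum>i\<in>A. \<Sum>j\<in>C. w (i, j))"
    using fin(2) CJ AI AD DJ V0 by (intro sum.cong sum.mono_neutral_right) (auto simp: D_def)
  also have "\<dots> = (\<Sum>j\<in>C. \<Sum>i\<in>A. w (i, j))" by (rule sum.swap)
  also have "\<dots> = (\<Sum>j\<in>C. \<Sum>i\<in>I. w (i, j))"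
    using fin(1) AI closed by (intro sum.cong sum.mono_neutral_left) auto
  also have "\<dots> = sum r C" using sat_col by simp
  finally have flowA: "(\<Sum>i\<in>A. \<Sum>j\<in>J. w (i, j)) = sum r C" .
  have "(\<Sum>i\<in>I - A. \<Sum>j\<in>J. w (i, j)) = sum p (I - A)"
    using row by (intro sum.cong) (force simp: A_def slack_def)+
  moreover have "T w = (\<Sum>i\<in>I - A. \<Sum>j\<in>J. w (i, j)) + (\<Sum>i\<in>A. \<Sum>j\<in>J. w (i, j))"
    unfolding T_def by (rule sum.subset_diff[OF AI fin(1)])
  ultimately have "T w = sum p (I - A) + sum r C" using flowA by simp
  moreover have "sum p I = sum p (I - A) + sum p A" by (rule sum.subset_diff[OF AI fin(1)])
  moreover have "sum r J = sum r D + sum r C" unfolding D_def by (rule sum.subset_diff[OF CJ fin(2)])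
  ultimately have big: "1 - T w \<le> s" using V[OF AI DJ AD] p(2) r(2) by simp
  \<comment> \<open>If \<open>t = 0\<close>, nothing is left over, and division by zero makes the product term vanish as it should.\<close>
  define a where "a i = p i - (\<Sum>j\<in>J. w (i, j))" for i
  define b where "b j = r j - (\<Sum>i\<in>I. w (i, j))" for j
  define t where "t = 1 - T w"
  have a0: "0 \<le> a i" if "i \<in> I" for i using row[OF that] by (simp add: a_def)
  have b0: "0 \<le> b j" if "j \<in> J" for j using col[OF that] by (simp add: b_def)
  have sa: "sum a I = t" by (simp add: a_def t_def sum_subtractf p(2) T_def)
  have sb: "sum b J = t" unfolding b_def t_def T_def sum_subtractf r(2) by (subst sum.swap) simp
  have t0: "0 \<le> t" using sum_nonneg[of I a] a0 sa by simp
  have at: "a i * t / t = a i" if "i \<in> I" for i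
    using that a0 sa fin(1) by (cases "t = 0") (auto simp: sum_nonneg_eq_0_iff)
  have bt: "b j * t / t = b j" if "j \<in> J" for j
    using that b0 sb fin(2) by (cases "t = 0") (auto simp: sum_nonneg_eq_0_iff)
  define v where "v i j = w (i, j) + a i * b j / t" for i j
  have "0 \<le> v i j" if "i \<in> I" "j \<in> J" for i j
    using wn[of "(i, j)"] a0[OF that(1)] b0[OF that(2)] t0 by (auto simp: v_def)
  moreover have "(\<Sum>j\<in>J. v i j) = p i" if "i \<in> I" for i
  proof -
    have "(\<Sum>j\<in>J. v i j) = (\<Sum>j\<in>J. w (i, j)) + a i * sum b J / t"
      by (simp add: v_def sum.distrib sum_distrib_left sum_divide_distrib)
    then show ?thesis using at[OF that] by (simp add: sb a_def)
  qed
  moreover have "(\<Sum>i\<in>I. v i j) = r j" if "j \<in> J" for j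
  proof -
    have "(\<Sum>i\<in>I. v i j) = (\<Sum>i\<in>I. w (i, j)) + b j * sum a I / t"
      by (simp add: v_def sum.distrib sum_distrib_left sum_divide_distrib mult.commute)
    then show ?thesis using bt[OF that] by (simp add: sa b_def)
  qed
  moreover have "(\<Sum>i\<in>I. \<Sum>j\<in>J. if V i j then v i j else 0) \<le> s"
  proof -
    have "(\<Sum>i\<in>I. \<Sum>j\<in>J. if V i j then v i j else 0) \<le> (\<Sum>i\<in>I. \<Sum>j\<in>J. a i * b j / t)"
      using a0 b0 t0 V0 by (intro sum_mono) (auto simp: v_def)
    also have "\<dots> = sum a I * sum b J / t"
      by (simp add: sum_product sum_divide_distrib)
    also have "\<dots> = t" by (simp add: sa sb)
    finally show ?thesis using big by (simp add: t_def)
  qed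
  ultimately show ?thesis by blast
qed

section \<open>Limits of random bit sequences\<close>

lemma (in finite_measure) measure_finite_fibres:
  assumes "finite A" "\<And>i. i \<in> A \<Longrightarrow> {x \<in> space M. f x = i} \<in> sets M"
  shows "measure M {x \<in> space M. f x \<in> A} = (\<Sum>i\<in>A. measure M {x \<in> space M. f x = i})"
proof -
  have "{x \<in> space M. f x \<in> A} = (\<Union>i\<in>A. {x \<in> space M. f x = i})" by auto
  then show ?thesis
    using assms by (simp only:) (rule finite_measure_finite_Union, auto simp: disjoint_family_on_def)
qed

lemma pointwise_convergent_subsequence:
  fixes f :: "nat \<Rightarrow> 'i::countable \<Rightarrow> real"
  assumes "\<And>n i. 0 \<le> f n i" "\<And>n i. f n i \<le> 1"
  shows "\<exists>l \<phi>. strict_mono \<phi> \<and> (\<forall>i. (\<lambda>n. f (\<phi> n) i) \<longlonglongrightarrow> l i)"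
proof -
  have "compactin euclidean (Pi\<^sub>E UNIV (\<lambda>_::'i. {0..1::real}))"
    unfolding euclidean_product_topology[symmetric] compactin_PiE by auto
  then have "seq_compact (Pi\<^sub>E UNIV (\<lambda>_::'i. {0..1::real}))"
    by (simp add: compact_imp_seq_compact)
  moreover have "\<forall>n. f n \<in> Pi\<^sub>E UNIV (\<lambda>_::'i. {0..1::real})"
    using assms by auto
  ultimately obtain l and \<phi> :: "nat \<Rightarrow> nat" where \<phi>: "strict_mono \<phi>" and lim: "(f \<circ> \<phi>) \<longlonglongrightarrow> l"
    unfolding seq_compact_def by metis
  have "(\<lambda>n. f (\<phi> n) i) \<longlonglongrightarrow> l i" for i
    using continuous_on_tendsto_compose[OF continuous_on_product_coordinates[of i] lim] by simp
  with \<phi> show ?thesis by blast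
qed

text \<open>
  The unit interval is cut successively: at stage \<open>n\<close> the cell of \<open>S \<subseteq> {..<n}\<close> has length \<open>q n S\<close>, and it is
  divided into a left part for bit \<open>n\<close> equal to \<open>0\<close> and a right part for bit \<open>n\<close> equal to \<open>1\<close>. This is the
  left end point of the cell.
\<close>

fun cell_left :: "(nat \<Rightarrow> nat set \<Rightarrow> real) \<Rightarrow> nat \<Rightarrow> nat set \<Rightarrow> real" where
  "cell_left q 0 S = 0"
| "cell_left q (Suc n) S =
    cell_left q n (S - {n}) + (if n \<in> S then q (Suc n) (S - {n}) else 0)"

text \<open>
  The Kolmogorov extension theorem for bits, in the explicit form that reads the bits off a uniformly
  distributed \<open>t\<close>: a point lies in exactly one cell of each stage, and bit \<open>n\<close> tells which of
  the two parts of its stage \<open>n\<close> cell it is in.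
\<close>

lemma bits_with_prescribed_law:
  fixes q :: "nat \<Rightarrow> nat set \<Rightarrow> real"
  assumes q0: "q 0 {} = 1"
    and nonneg: "\<And>n S. 0 \<le> q n S"
    and split: "\<And>n S. S \<subseteq> {..<n} \<Longrightarrow> q n S = q (Suc n) S + q (Suc n) (insert n S)"
  shows "\<exists>\<beta>::nat \<Rightarrow> real set. (\<forall>k. \<beta> k \<in> sets borel) \<and>
    (\<forall>n. \<forall>S\<subseteq>{..<n}. measure (uniform_measure lborel {0..<1}) {t. {k. k < n \<and> t \<in> \<beta> k} = S} = q n S)"
proof -
  let ?U = "uniform_measure lborel {0..<1::real}"
  define cell where "cell n S = {cell_left q n S ..< cell_left q n S + q n S}" for n S
  define \<beta> where "\<beta> n = (\<Union>S\<in>Pow {..<n}. cell (Suc n) (insert n S))" for n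
  have left: "cell_left q (Suc n) S = cell_left q n S"
     "cell_left q (Suc n) (insert n S) = cell_left q n S + q (Suc n) S" if "S \<subseteq> {..<n}" for n S
  proof -
    have [simp]: "n \<notin> S" "S - {n} = S" using that by auto
    show "cell_left q (Suc n) S = cell_left q n S"
     "cell_left q (Suc n) (insert n S) = cell_left q n S + q (Suc n) S" by auto
  qed
  have cut: "cell n S = cell (Suc n) S \<union> cell (Suc n) (insert n S)"
     "cell (Suc n) S \<inter> cell (Suc n) (insert n S) = {}" if "S \<subseteq> {..<n}" for n S
    using split[OF that] nonneg[of "Suc n" S] nonneg[of "Suc n" "insert n S"]
    unfolding cell_def left[OF that] by auto
  have path: "{t \<in> {0..<1}. {k. k < n \<and> t \<in> \<beta> k} = S} = cell n S" if "S \<subseteq> {..<n}" for n S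
    using that
  proof (induction n arbitrary: S)
    case 0
    then show ?case using q0 by (auto simp: cell_def)
  next
    case (Suc n)
    define R where "R = S - {n}"
    have R: "R \<subseteq> {..<n}" using Suc.prems by (auto simp: R_def less_Suc_eq)
    have \<beta>: "t \<in> \<beta> n \<longleftrightarrow> t \<in> cell (Suc n) (insert n R)" if t: "t \<in> cell n R" for t
    proof
      assume "t \<in> \<beta> n"
      then obtain R' where R': "R' \<subseteq> {..<n}" "t \<in> cell (Suc n) (insert n R')"
        by (auto simp: \<beta>_def)
      then have "t \<in> cell n R'" using cut(1)[OF R'(1)] by blast
      then have "R' = R" using t Suc.IH[OF R'(1)] Suc.IH[OF R] by blast
      then show "t \<in> cell (Suc n) (insert n R)" using R' by simp
    qed (use R in \<open>auto simp: \<beta>_def\<close>)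
    have "{k. k < Suc n \<and> t \<in> \<beta> k} = S \<longleftrightarrow>
        {k. k < n \<and> t \<in> \<beta> k} = R \<and> (t \<in> \<beta> n \<longleftrightarrow> n \<in> S)" for t
      using Suc.prems by (auto simp: R_def less_Suc_eq set_eq_iff)
    then have "{t \<in> {0..<1}. {k. k < Suc n \<and> t \<in> \<beta> k} = S} =
        {t \<in> cell n R. t \<in> \<beta> n \<longleftrightarrow> n \<in> S}"
      using Suc.IH[OF R] by auto
    also have "\<dots> = {t \<in> cell n R. t \<in> cell (Suc n) (insert n R) \<longleftrightarrow> n \<in> S}"
      using \<beta> by blast
    also have "\<dots> = cell (Suc n) S"
    proof (cases "n \<in> S")
      case True
      then have "insert n R = S" by (auto simp: R_def)
      then show ?thesis using True cut[OF R] by auto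
    next
      case False
      then have "R = S" by (auto simp: R_def)
      then show ?thesis using False cut[OF R] by auto
    qed
    finally show ?case .
  qed
  have \<beta>[measurable]: "\<beta> k \<in> sets borel" for k
    unfolding \<beta>_def by (intro sets.finite_UN) (auto simp: cell_def)
  have "measure ?U {t. {k. k < n \<and> t \<in> \<beta> k} = S} = q n S" if "S \<subseteq> {..<n}" for n S
  proof -
    have "{t. {k. k < n \<and> t \<in> \<beta> k} = S} \<in> sets lborel"
      using that by (simp add: set_eq_iff) measurable
    then have "measure ?U {t. {k. k < n \<and> t \<in> \<beta> k} = S} =
        measure lborel ({0..<1} \<inter> {t. {k. k < n \<and> t \<in> \<beta> k} = S})"
      by (subst measure_uniform_measure) auto
    also have "{0..<1} \<inter> {t. {k. k < n \<and> t \<in> \<beta> k} = S} = cell n S"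
      using path[OF that] by (simp only: Collect_conj_eq Collect_mem_eq)
    also have "measure lborel (cell n S) = q n S" using nonneg by (simp add: cell_def)
    finally show ?thesis .
  qed
  with \<beta> show ?thesis by blast
qed

text \<open>
  All probabilities of finite bit patterns converge along one subsequence, as there are only countably
  many patterns. The limits are again consistent, and consistency alone suffices to realise them by
  random bits: no countable additivity can be lost for events that depend on finitely many bits.
\<close>

lemma limit_law_of_bits:
  fixes \<theta> :: "nat \<Rightarrow> 'a measure" and E :: "nat \<Rightarrow> 'a set"
  assumes prob: "\<And>m. prob_space (\<theta> m)"
    and E: "\<And>m k. E k \<in> sets (\<theta> m)"
  shows "\<exists>(\<phi>::nat \<Rightarrow> nat) (\<beta>::nat \<Rightarrow> real set). strict_mono \<phi> \<and> (\<forall>k. \<beta> k \<in> sets borel) \<and>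
    (\<forall>n Q. (\<lambda>m. measure (\<theta> (\<phi> m)) {x \<in> space (\<theta> (\<phi> m)). Q {k. k < n \<and> x \<in> E k}})
      \<longlonglongrightarrow> measure (uniform_measure lborel {0..<1}) {t. Q {k. k < n \<and> t \<in> \<beta> k}})"
proof -
  define c where "c m n S = measure (\<theta> m) {x \<in> space (\<theta> m). {k. k < n \<and> x \<in> E k} = S}" for m n S
  have meas: "{x \<in> space (\<theta> m). {k. k < n \<and> x \<in> E k} = S} \<in> sets (\<theta> m)" for m n S
  proof -
    note [measurable] = E[of _ m]
    have "{x \<in> space (\<theta> m). {k. k < n \<and> x \<in> E k} = S} =
      {x \<in> space (\<theta> m). \<forall>k. (k < n \<and> x \<in> E k) = (k \<in> S)}" by (auto simp: set_eq_iff)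
    also have "\<dots> \<in> sets (\<theta> m)" by measurable
    finally show ?thesis .
  qed
  have "0 \<le> c m n S" "c m n S \<le> 1" for m n S
    using prob_space.prob_le_1[OF prob] by (auto simp: c_def)
  then have "\<exists>l \<phi>. strict_mono \<phi> \<and> (\<forall>i. (\<lambda>m. c (\<phi> m) (fst i) (set_decode (snd i))) \<longlonglongrightarrow> l i)"
    by (intro pointwise_convergent_subsequence)
  then obtain l and \<phi> :: "nat \<Rightarrow> nat" where \<phi>: "strict_mono \<phi>"
    and l: "\<And>i. (\<lambda>m. c (\<phi> m) (fst i) (set_decode (snd i))) \<longlonglongrightarrow> l i" by blast
  \<comment> \<open>Finite sets of indices are coded by numbers, which makes the set of all patterns countable.\<close>
  define q where "q n S = (if S \<subseteq> {..<n} then l (n, set_encode S) else 0)" for n S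
  have lim: "(\<lambda>m. c (\<phi> m) n S) \<longlonglongrightarrow> q n S" if "S \<subseteq> {..<n}" for n S
    using l[of "(n, set_encode S)"] that
    by (simp add: q_def set_encode_inverse finite_subset[OF that finite_lessThan])
  have "q 0 {} = 1"
  proof -
    have "(\<lambda>m. 1) \<longlonglongrightarrow> q 0 {}"
      using lim[of "{}" 0] prob_space.prob_space[OF prob] by (simp add: c_def)
    then show ?thesis by (metis LIMSEQ_const_iff)
  qed
  moreover have "0 \<le> q n S" for n S
    using LIMSEQ_le_const[OF lim[of S n], of 0] by (auto simp: q_def c_def)
  moreover have "q n S = q (Suc n) S + q (Suc n) (insert n S)" if S: "S \<subseteq> {..<n}" for n S
  proof -
    have "n \<notin> S" using S by auto
    have "c m n S = c m (Suc n) S + c m (Suc n) (insert n S)" for m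
    proof -
      interpret prob_space "\<theta> m" by (rule prob)
      have "{x \<in> space (\<theta> m). {k. k < n \<and> x \<in> E k} = S} =
          {x \<in> space (\<theta> m). {k. k < Suc n \<and> x \<in> E k} = S} \<union>
          {x \<in> space (\<theta> m). {k. k < Suc n \<and> x \<in> E k} = insert n S}"
        using S by (auto simp: less_Suc_eq set_eq_iff)
      then show ?thesis
        unfolding c_def using \<open>n \<notin> S\<close>
        by (simp only:) (subst finite_measure_Union, auto simp: meas)
    qed
    then have "(\<lambda>m. c (\<phi> m) n S) \<longlonglongrightarrow> q (Suc n) S + q (Suc n) (insert n S)"
      using S by (simp only:) (intro tendsto_add lim, auto)
    then show ?thesis using lim[OF S] LIMSEQ_unique by blast
  qed
  ultimately have "\<exists>\<beta>::nat \<Rightarrow> real set. (\<forall>k. \<beta> k \<in> sets borel) \<and>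
    (\<forall>n. \<forall>S\<subseteq>{..<n}. measure (uniform_measure lborel {0..<1}) {t. {k. k < n \<and> t \<in> \<beta> k} = S} = q n S)"
    by (rule bits_with_prescribed_law)
  then obtain \<beta> :: "nat \<Rightarrow> real set" where \<beta>: "\<And>k. \<beta> k \<in> sets borel"
    and law: "\<And>n S. S \<subseteq> {..<n} \<Longrightarrow>
      measure (uniform_measure lborel {0..<1}) {t. {k. k < n \<and> t \<in> \<beta> k} = S} = q n S"
    by blast
  let ?U = "uniform_measure lborel {0..<1::real}"
  interpret U: prob_space ?U by (rule prob_space_uniform_measure) auto
  have U_meas: "{t. {k. k < n \<and> t \<in> \<beta> k} = S} \<in> sets ?U" for n S
    using \<beta> by (simp add: set_eq_iff) measurable
  have "(\<lambda>m. measure (\<theta> (\<phi> m)) {x \<in> space (\<theta> (\<phi> m)). Q {k. k < n \<and> x \<in> E k}})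
      \<longlonglongrightarrow> measure ?U {t. Q {k. k < n \<and> t \<in> \<beta> k}}" for n Q
  proof -
    define H where "H = {S \<in> Pow {..<n}. Q S}"
    have H: "finite H" by (simp add: H_def)
    have "measure (\<theta> m) {x \<in> space (\<theta> m). Q {k. k < n \<and> x \<in> E k}} = (\<Sum>S\<in>H. c m n S)" for m
    proof -
      interpret prob_space "\<theta> m" by (rule prob)
      have "{x \<in> space (\<theta> m). Q {k. k < n \<and> x \<in> E k}} =
        {x \<in> space (\<theta> m). {k. k < n \<and> x \<in> E k} \<in> H}" by (auto simp: H_def)
      then show ?thesis
        unfolding c_def by (simp only: measure_finite_fibres[OF H meas])
    qed
    moreover have "measure ?U {t. Q {k. k < n \<and> t \<in> \<beta> k}} = (\<Sum>S\<in>H. q n S)"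
    proof -
      have "{t. Q {k. k < n \<and> t \<in> \<beta> k}} = {t \<in> space ?U. {k. k < n \<and> t \<in> \<beta> k} \<in> H}"
        by (auto simp: H_def)
      also have "measure ?U \<dots> = (\<Sum>S\<in>H. measure ?U {t \<in> space ?U. {k. k < n \<and> t \<in> \<beta> k} = S})"
        using U_meas by (intro U.measure_finite_fibres H) simp
      also have "\<dots> = (\<Sum>S\<in>H. measure ?U {t. {k. k < n \<and> t \<in> \<beta> k} = S})" by simp
      also have "\<dots> = (\<Sum>S\<in>H. q n S)" by (intro sum.cong law) (auto simp: H_def)
      finally show ?thesis .
    qed
    ultimately show ?thesis
      by (simp only:) (intro tendsto_sum lim, auto simp: H_def)
  qed
  then show ?thesis by (intro exI[of _ \<phi>] exI[of _ \<beta>] conjI allI \<phi> \<beta>)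
qed

abbreviation bit_space :: "(nat \<Rightarrow> bool) measure" where
  "bit_space \<equiv> Pi\<^sub>M UNIV (\<lambda>_. count_space UNIV)"

lemma finitely_many_bits_measurable:
  fixes P P' :: "nat \<Rightarrow> 'a \<Rightarrow> bool"
  assumes [measurable]: "\<And>k. Measurable.pred M (P k)" "\<And>k. Measurable.pred M (P' k)"
  shows "{x \<in> space M. Q {k. k < n \<and> P k x} {k. k < n \<and> P' k x}} \<in> sets M"
proof -
  have "{x \<in> space M. Q {k. k < n \<and> P k x} {k. k < n \<and> P' k x}} =
    (\<Union>(S, T)\<in>{(S, T) \<in> Pow {..<n} \<times> Pow {..<n}. Q S T}.
      {x \<in> space M. (\<forall>k. (k < n \<and> P k x) = (k \<in> S)) \<and> (\<forall>k. (k < n \<and> P' k x) = (k \<in> T))})"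
    (is "_ = ?R")
  proof (intro set_eqI iffI)
    fix x assume "x \<in> {x \<in> space M. Q {k. k < n \<and> P k x} {k. k < n \<and> P' k x}}"
    then show "x \<in> ?R"
      by (intro UN_I[of "({k. k < n \<and> P k x}, {k. k < n \<and> P' k x})"]) auto
  next
    fix x assume "x \<in> ?R"
    then obtain S T where "x \<in> space M" "Q S T"
      "\<And>k. (k < n \<and> P k x) = (k \<in> S)" "\<And>k. (k < n \<and> P' k x) = (k \<in> T)" by auto
    moreover from this have "{k. k < n \<and> P k x} = S" "{k. k < n \<and> P' k x} = T" by auto
    ultimately show "x \<in> {x \<in> space M. Q {k. k < n \<and> P k x} {k. k < n \<and> P' k x}}" by simp
  qed
  also have "\<dots> \<in> sets M"
  proof (rule sets.finite_UN)
    show "finite {(S, T) \<in> Pow {..<n} \<times> Pow {..<n}. Q S T}"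
      by (rule finite_subset[of _ "Pow {..<n} \<times> Pow {..<n}"]) auto
  qed (auto split: prod.split)
  finally show ?thesis .
qed

lemma law_of_bits_eqI:
  assumes "prob_space M" "prob_space N"
    and Z: "Z \<in> measurable M bit_space" and Z': "Z' \<in> measurable N bit_space"
    and eq: "\<And>n Q. measure M {x \<in> space M. Q {k. k < n \<and> Z x k}} =
      measure N {x \<in> space N. Q {k. k < n \<and> Z' x k}}"
  shows "distr M bit_space Z = distr N bit_space Z'"
proof (rule measure_eqI_PiM_infinite)
  interpret M: prob_space M by fact
  interpret N: prob_space N by fact
  interpret D: prob_space "distr M bit_space Z" by (rule M.prob_space_distr[OF Z])
  show "finite_measure (distr M bit_space Z)" by (rule D.finite_measure_axioms)
  fix A :: "nat \<Rightarrow> bool set" and J :: "nat set"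
  assume J: "finite J"
  let ?X = "prod_emb UNIV (\<lambda>_. count_space UNIV) J (Pi\<^sub>E J A)"
  have X: "?X \<in> sets bit_space" by (rule sets_PiM_I) (use J in auto)
  obtain n where n: "J \<subseteq> {..<n}" using finite_nat_bounded[OF J] by auto
  have mem: "z \<in> ?X \<longleftrightarrow> (\<forall>j\<in>J. (j \<in> {k. k < n \<and> z k}) \<in> A j)" for z
    using n by (auto simp: prod_emb_def PiE_iff subset_eq)
  have "measure M (Z -` ?X \<inter> space M) = measure N (Z' -` ?X \<inter> space N)"
    using eq[of "\<lambda>H. \<forall>j\<in>J. (j \<in> H) \<in> A j" n]
    unfolding vimage_def mem Collect_conj_eq[symmetric] Int_def mem_Collect_eq
    by (simp add: conj_commute)
  then show "emeasure (distr M bit_space Z) ?X = emeasure (distr N bit_space Z') ?X"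
    by (simp add: emeasure_distr[OF Z X] emeasure_distr[OF Z' X]
        M.emeasure_eq_measure N.emeasure_eq_measure)
qed simp_all

section \<open>Encoding points of a Polish space by bits\<close>

text \<open>
  Balls around the points of a dense sequence, with radii \<open>1/(n+1)\<close>, are a countable base. A point is
  recovered from the set of balls containing it as the limit of the first centre of each radius.
\<close>

definition dense_seq :: "nat \<Rightarrow> 'a::polish_space" where
  "dense_seq = (SOME s. \<forall>x. \<forall>e>0. \<exists>i. dist (s i) x < e)"

definition base_ball :: "nat \<Rightarrow> 'a::polish_space set" where
  "base_ball k = ball (dense_seq (fst (prod_decode k))) (1 / real (Suc (snd (prod_decode k))))"

definition code :: "'a::polish_space \<Rightarrow> nat \<Rightarrow> bool" where
  "code x k \<longleftrightarrow> x \<in> base_ball k"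

definition centre :: "(nat \<Rightarrow> bool) \<Rightarrow> nat \<Rightarrow> 'a::polish_space" where
  "centre z n = dense_seq (LEAST i. z (prod_encode (i, n)))"

text \<open>
  The case distinction keeps \<open>decode\<close> measurable: it is everywhere the limit of measurable functions,
  constant ones where the centres do not converge.
\<close>

definition decode :: "(nat \<Rightarrow> bool) \<Rightarrow> 'a::polish_space" where
  "decode z = (if Cauchy (centre z :: nat \<Rightarrow> 'a) then lim (centre z) else undefined)"

lemma dense_seq: "e > 0 \<Longrightarrow> \<exists>i. dist (dense_seq i) (x::'a::polish_space) < e"
proof -
  obtain D :: "'a set" where D: "countable D" "\<And>X. open X \<Longrightarrow> X \<noteq> {} \<Longrightarrow> \<exists>d\<in>D. d \<in> X"
    using countable_dense_setE by blast
  have "D \<noteq> {}" using D(2)[of UNIV] by auto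
  have "\<exists>i. dist (from_nat_into D i) x < e" if pos: "e > 0" for x and e :: real
  proof -
    obtain d where "d \<in> D" "d \<in> ball x e" using D(2)[of "ball x e"] pos by auto
    moreover obtain i where "from_nat_into D i = d"
      using from_nat_into_surj[OF D(1) \<open>d \<in> D\<close>] by blast
    ultimately show ?thesis by (auto simp: dist_commute)
  qed
  then have "\<exists>s::nat \<Rightarrow> 'a. \<forall>x. \<forall>e>0. \<exists>i. dist (s i) x < e"
    by (intro exI[of _ "from_nat_into D"]) blast
  then have "\<forall>x::'a. \<forall>e>0. \<exists>i. dist (dense_seq i) x < e"
    unfolding dense_seq_def by (rule someI_ex)
  then show "e > 0 \<Longrightarrow> ?thesis" by blast
qed

lemma open_base_ball: "open (base_ball k)"
  by (simp add: base_ball_def)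

lemma base_ball_basis:
  fixes x :: "'a::polish_space"
  assumes "open U" "x \<in> U"
  shows "\<exists>k. x \<in> base_ball k \<and> base_ball k \<subseteq> U"
proof -
  obtain e where e: "e > 0" "ball x e \<subseteq> U" using assms open_contains_ball by blast
  obtain n where n: "1 / real (Suc n) < e / 2"
    using reals_Archimedean[of "e / 2"] e(1) by (auto simp: inverse_eq_divide)
  obtain i where i: "dist (dense_seq i) x < 1 / real (Suc n)" using dense_seq[of "1 / real (Suc n)" x] by auto
  have "base_ball (prod_encode (i, n)) \<subseteq> ball x e"
  proof
    fix y :: 'a assume "y \<in> base_ball (prod_encode (i, n))"
    then have "dist (dense_seq i) y < 1 / real (Suc n)" by (simp add: base_ball_def)
    then show "y \<in> ball x e"
      using dist_triangle[of x y "dense_seq i"] i n by (simp add: dist_commute)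
  qed
  then show ?thesis
    using e(2) i by (intro exI[of _ "prod_encode (i, n)"]) (auto simp: base_ball_def)
qed

lemma decode_code: "decode (code x) = x"
proof -
  have "dist (centre (code x) n) x < inverse (real (Suc n))" for n
  proof -
    have "\<exists>i. code x (prod_encode (i, n))"
      using dense_seq[of "1 / real (Suc n)" x] by (auto simp: code_def base_ball_def)
    then have "code x (prod_encode (LEAST i. code x (prod_encode (i, n)), n))" by (rule LeastI_ex)
    then show ?thesis by (simp add: code_def base_ball_def centre_def inverse_eq_divide)
  qed
  then have "(\<lambda>n. dist (centre (code x) n) x) \<longlonglongrightarrow> 0"
    by (intro tendsto_sandwich[OF _ _ tendsto_const LIMSEQ_inverse_real_of_nat])
      (auto intro: always_eventually less_imp_le)
  then have "centre (code x) \<longlonglongrightarrow> x" by (subst tendsto_dist_iff)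
  then show ?thesis by (auto simp: decode_def limI dest: LIMSEQ_imp_Cauchy)
qed

lemma code_measurable [measurable]: "(code :: 'a::polish_space \<Rightarrow> _) \<in> measurable borel bit_space"
proof (rule measurable_PiM_single')
  fix k :: nat
  have [measurable]: "(base_ball k :: 'a set) \<in> sets borel" by (intro borel_open open_base_ball)
  show "(\<lambda>x::'a. code x k) \<in> measurable borel (count_space UNIV)"
    unfolding code_def by measurable
qed simp

lemma decode_measurable [measurable]: "(decode :: _ \<Rightarrow> 'a::polish_space) \<in> measurable bit_space borel"
proof (rule borel_measurable_LIMSEQ_metric)
  have [measurable]: "(\<lambda>z. centre z n :: 'a) \<in> measurable bit_space borel" for n
  proof -
    have "(\<lambda>z. LEAST i. z (prod_encode (i, n))) \<in> measurable bit_space (count_space UNIV)"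
      by measurable
    then show ?thesis
      unfolding centre_def by (rule measurable_compose) simp
  qed
  show "(\<lambda>z. if Cauchy (centre z :: nat \<Rightarrow> 'a) then centre z n else undefined :: 'a) \<in> measurable bit_space borel" for n
    by measurable
  show "(\<lambda>n. if Cauchy (centre z :: nat \<Rightarrow> 'a) then centre z n else undefined :: 'a) \<longlonglongrightarrow> decode z" for z
    by (auto simp: decode_def Cauchy_convergent_iff convergent_LIMSEQ_iff)
qed

section \<open>Sequential compactness of couplings\<close>

text \<open>
  Sequential compactness of the couplings, with convergence tested on the finite algebras generated by
  basic balls. The limit law of the bits of both coordinates is decoded to a law on pairs. Each half of
  the bits has the law of the codes of \<open>\<mu>1\<close> or \<open>\<mu>2\<close>, because the marginals do not depend on \<open>m\<close>. Therefore
  almost every bit sequence is the code of a point, so that decoding loses nothing, and the marginals of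
  the limit are \<open>\<mu>1\<close> and \<open>\<mu>2\<close> again.
\<close>

lemma couplings_limit:
  fixes \<mu>1 \<mu>2 :: "'a::polish_space measure"
  assumes \<mu>: "borel_prob \<mu>1" "borel_prob \<mu>2"
    and \<theta>: "\<And>m. \<theta> m \<in> couplings \<mu>1 \<mu>2"
  shows "\<exists>\<theta>'\<in>couplings \<mu>1 \<mu>2. \<exists>\<phi>::nat \<Rightarrow> nat. strict_mono \<phi> \<and> (\<forall>n Q.
    (\<lambda>m. measure (\<theta> (\<phi> m)) {(x, y). Q {k. k < n \<and> code x k} {k. k < n \<and> code y k}})
      \<longlonglongrightarrow> measure \<theta>' {(x, y). Q {k. k < n \<and> code x k} {k. k < n \<and> code y k}})"
proof -
  interpret p1: prob_space \<mu>1 using \<mu> by (simp add: borel_prob_def)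
  interpret p2: prob_space \<mu>2 using \<mu> by (simp add: borel_prob_def)
  have s\<mu>[measurable_cong]: "sets \<mu>1 = sets borel" "sets \<mu>2 = sets borel"
    using \<mu> by (auto simp: borel_prob_def)
  have sp\<mu>: "space \<mu>1 = UNIV" "space \<mu>2 = UNIV" using s\<mu>[THEN sets_eq_imp_space_eq] by auto
  have prob: "prob_space (\<theta> m)" and s\<theta>[measurable_cong]: "sets (\<theta> m) = sets borel"
    and d1: "distr (\<theta> m) borel fst = \<mu>1" and d2: "distr (\<theta> m) borel snd = \<mu>2" for m
    using \<theta>[of m] by (auto simp: couplings_def borel_prob_def)
  have sp\<theta>: "space (\<theta> m) = UNIV" for m using s\<theta>[THEN sets_eq_imp_space_eq] by auto
  have fs[measurable]: "fst \<in> borel_measurable (borel :: ('a \<times> 'a) measure)"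
    "snd \<in> borel_measurable (borel :: ('a \<times> 'a) measure)"
    by (auto intro!: borel_measurable_continuous_onI continuous_intros)
  have code_k[measurable]: "Measurable.pred borel (\<lambda>x::'a. code x k)" for k
    using measurable_compose[OF code_measurable measurable_component_singleton[of k UNIV]] by simp
  \<comment> \<open>The bits of the two coordinates are interleaved: even ones for \<open>x\<close>, odd ones for \<open>y\<close>.\<close>
  define E :: "nat \<Rightarrow> ('a \<times> 'a) set"
    where "E k = {(x, y). if even k then code x (k div 2) else code y (k div 2)}" for k
  have "E k \<in> sets (\<theta> m)" for k m
  proof -
    have "{z \<in> space borel. if even k then code (fst z :: 'a) (k div 2) else code (snd z :: 'a) (k div 2)}
        \<in> sets borel" by measurable
    then show ?thesis by (simp add: E_def s\<theta> case_prod_unfold)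
  qed
  from limit_law_of_bits[of \<theta> E, OF prob this]
  obtain \<phi> :: "nat \<Rightarrow> nat" and \<beta> :: "nat \<Rightarrow> real set" where \<phi>: "strict_mono \<phi>"
    and \<beta>[measurable]: "\<And>k. \<beta> k \<in> sets borel"
    and lim0: "\<forall>n Q. (\<lambda>m. measure (\<theta> (\<phi> m)) {x \<in> space (\<theta> (\<phi> m)). Q {k. k < n \<and> x \<in> E k}})
      \<longlonglongrightarrow> measure (uniform_measure lborel {0..<1}) {t. Q {k. k < n \<and> t \<in> \<beta> k}}"
    by blast
  define U :: "real measure" where "U = uniform_measure lborel {0..<1}"
  interpret U: prob_space U unfolding U_def by (rule prob_space_uniform_measure) auto
  have sU[measurable_cong]: "sets U = sets borel" by (simp add: U_def)
  have spU: "space U = UNIV" by (simp add: U_def)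
  define Z1 where "Z1 t k \<longleftrightarrow> t \<in> \<beta> (2 * k)" for t k
  define Z2 where "Z2 t k \<longleftrightarrow> t \<in> \<beta> (2 * k + 1)" for t k
  have Z[measurable]: "Z1 \<in> measurable U bit_space" "Z2 \<in> measurable U bit_space"
    unfolding Z1_def[abs_def] Z2_def[abs_def] by (auto intro!: measurable_PiM_single')
  have lim: "(\<lambda>m. measure (\<theta> (\<phi> m)) {(x, y). Q {k. k < n \<and> code x k} {k. k < n \<and> code y k}})
      \<longlonglongrightarrow> measure U {t. Q {k. k < n \<and> Z1 t k} {k. k < n \<and> Z2 t k}}" for n Q
  proof -
    define Q' where "Q' H = Q {k. k < n \<and> 2 * k \<in> H} {k. k < n \<and> 2 * k + 1 \<in> H}" for H
    have "Q' {k. k < 2 * n \<and> z \<in> E k} \<longleftrightarrow>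
      Q {k. k < n \<and> code (fst z) k} {k. k < n \<and> code (snd z) k}" for z
      unfolding Q'_def by (intro arg_cong2[where f=Q]) (auto simp: E_def)
    moreover have "Q' {k. k < 2 * n \<and> t \<in> \<beta> k} \<longleftrightarrow> Q {k. k < n \<and> Z1 t k} {k. k < n \<and> Z2 t k}" for t
      unfolding Q'_def by (intro arg_cong2[where f=Q]) (auto simp: Z1_def Z2_def)
    ultimately show ?thesis
      using lim0[rule_format, of Q' "2 * n"] by (simp add: sp\<theta> U_def case_prod_unfold)
  qed
  have meas1: "{x. Q {k. k < n \<and> code x k}} \<in> sets borel" for Q n
    using finitely_many_bits_measurable[where P="\<lambda>k x. code x k" and M=borel and P'="\<lambda>k x. code x k" and Q="\<lambda>S T. Q S" and n=n]
    by simp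
  have law1: "distr U bit_space Z1 = distr \<mu>1 bit_space code"
  proof (rule law_of_bits_eqI)
    fix n Q
    have "measure (\<theta> m) {(x, y). Q {k. k < n \<and> code x k}} = measure \<mu>1 {x. Q {k. k < n \<and> code x k}}" for m
      unfolding d1[of m, symmetric]
      by (subst measure_distr) (auto simp: meas1 sp\<theta> intro!: arg_cong[where f="measure _"])
    then have "(\<lambda>m. measure \<mu>1 {x. Q {k. k < n \<and> code x k}}) \<longlonglongrightarrow> measure U {t. Q {k. k < n \<and> Z1 t k}}"
      using lim[of "\<lambda>S T. Q S" n] by simp
    then show "measure U {t \<in> space U. Q {k. k < n \<and> Z1 t k}} =
        measure \<mu>1 {x \<in> space \<mu>1. Q {k. k < n \<and> code x k}}"
      by (simp add: sp\<mu> spU LIMSEQ_const_iff)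
  qed (use U.prob_space_axioms p1.prob_space_axioms in measurable)
  have law2: "distr U bit_space Z2 = distr \<mu>2 bit_space code"
  proof (rule law_of_bits_eqI)
    fix n Q
    have "measure (\<theta> m) {(x, y). Q {k. k < n \<and> code y k}} = measure \<mu>2 {x. Q {k. k < n \<and> code x k}}" for m
      unfolding d2[of m, symmetric]
      by (subst measure_distr) (auto simp: meas1 sp\<theta> intro!: arg_cong[where f="measure _"])
    then have "(\<lambda>m. measure \<mu>2 {x. Q {k. k < n \<and> code x k}}) \<longlonglongrightarrow> measure U {t. Q {k. k < n \<and> Z2 t k}}"
      using lim[of "\<lambda>S T. Q T" n] by simp
    then show "measure U {t \<in> space U. Q {k. k < n \<and> Z2 t k}} =
        measure \<mu>2 {x \<in> space \<mu>2. Q {k. k < n \<and> code x k}}"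
      by (simp add: sp\<mu> spU LIMSEQ_const_iff)
  qed (use U.prob_space_axioms p2.prob_space_axioms in measurable)
  define T where "T t = (decode (Z1 t) :: 'a, decode (Z2 t) :: 'a)" for t
  have T[measurable]: "T \<in> measurable U borel"
    unfolding T_def[abs_def] by measurable
  define \<theta>' where "\<theta>' = distr U borel T"
  have decoded: "distr U borel (\<lambda>t. decode (Z t)) = \<mu>"
    if Z: "Z \<in> measurable U bit_space" and law: "distr U bit_space Z = distr \<mu> bit_space code"
      and \<mu>: "sets \<mu> = sets borel" for Z and \<mu> :: "'a measure"
  proof -
    have code: "code \<in> measurable \<mu> bit_space"
      using code_measurable measurable_cong_sets[OF \<mu> refl] by blast
    have "distr U borel (\<lambda>t. decode (Z t)) = distr (distr U bit_space Z) borel decode"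
      by (subst distr_distr[OF decode_measurable Z]) (simp add: comp_def)
    also have "\<dots> = distr \<mu> borel (\<lambda>x. x)"
      unfolding law by (subst distr_distr[OF decode_measurable code]) (simp add: comp_def decode_code)
    also have "\<dots> = \<mu>" using distr_id2[of borel \<mu>] \<mu> by (simp add: id_def)
    finally show ?thesis .
  qed
  have "distr \<theta>' borel fst = \<mu>1"
    unfolding \<theta>'_def by (subst distr_distr[OF fs(1) T]) (simp add: comp_def T_def decoded[OF Z(1) law1 s\<mu>(1)])
  moreover have "distr \<theta>' borel snd = \<mu>2"
    unfolding \<theta>'_def by (subst distr_distr[OF fs(2) T]) (simp add: comp_def T_def decoded[OF Z(2) law2 s\<mu>(2)])
  moreover have "borel_prob \<theta>'"
    unfolding borel_prob_def \<theta>'_def using U.prob_space_distr[OF T] by simp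
  ultimately have \<theta>': "\<theta>' \<in> couplings \<mu>1 \<mu>2" by (simp add: couplings_def)
  have recode: "AE t in U. code (decode (Z t) :: 'a) = Z t"
    if Z: "Z \<in> measurable U bit_space" and law: "distr U bit_space Z = distr \<mu> bit_space code"
      and \<mu>: "sets \<mu> = sets borel" for Z and \<mu> :: "'a measure"
  proof -
    have code: "code \<in> measurable \<mu> bit_space"
      using code_measurable measurable_cong_sets[OF \<mu> refl] by blast
    have m: "{z \<in> space bit_space. code (decode z :: 'a) = z} \<in> sets bit_space"
      unfolding fun_eq_iff by measurable
    have "AE z in distr \<mu> bit_space code. code (decode z :: 'a) = z"
      by (subst AE_distr_iff[OF code m]) (simp add: decode_code)
    then show ?thesis
      unfolding law[symmetric] by (subst (asm) AE_distr_iff[OF Z m])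
  qed
  have "measure \<theta>' {(x, y). Q {k. k < n \<and> code x k} {k. k < n \<and> code y k}} =
      measure U {t. Q {k. k < n \<and> Z1 t k} {k. k < n \<and> Z2 t k}}" for n Q
  proof -
    have 1: "{(x::'a, y::'a). Q {k. k < n \<and> code x k} {k. k < n \<and> code y k}} \<in> sets borel"
      using finitely_many_bits_measurable[where P="\<lambda>k z. code (fst z :: 'a) k" and M=borel and P'="\<lambda>k z. code (snd z :: 'a) k" and Q=Q and n=n]
      by (simp add: case_prod_unfold)
    have 2: "{t. Q {k. k < n \<and> Z1 t k} {k. k < n \<and> Z2 t k}} \<in> sets U"
      using finitely_many_bits_measurable[where P="\<lambda>k t. Z1 t k" and M=U and P'="\<lambda>k t. Z2 t k" and Q=Q and n=n]
        measurable_compose[OF Z(1) measurable_component_singleton[of _ UNIV]]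
        measurable_compose[OF Z(2) measurable_component_singleton[of _ UNIV]]
      by (simp add: spU)
    have "measure \<theta>' {(x, y). Q {k. k < n \<and> code x k} {k. k < n \<and> code y k}} =
        measure U (T -` {(x, y). Q {k. k < n \<and> code x k} {k. k < n \<and> code y k}} \<inter> space U)"
      unfolding \<theta>'_def by (rule measure_distr[OF T 1])
    also have "\<dots> = measure U {t. Q {k. k < n \<and> Z1 t k} {k. k < n \<and> Z2 t k}}"
    proof (rule measure_eq_AE)
      show "AE t in U. (t \<in> T -` {(x, y). Q {k. k < n \<and> code x k} {k. k < n \<and> code y k}} \<inter> space U) =
          (t \<in> {t. Q {k. k < n \<and> Z1 t k} {k. k < n \<and> Z2 t k}})"
        using recode[OF Z(1) law1 s\<mu>(1)] recode[OF Z(2) law2 s\<mu>(2)]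
        by eventually_elim (simp add: T_def spU)
    qed (use 2 measurable_sets[OF T 1] in auto)
    finally show ?thesis .
  qed
  with lim \<theta>' \<phi> show ?thesis
    by (intro bexI[of _ \<theta>'] exI[of _ \<phi>]) auto
qed

section \<open>Strassen's theorem for open sets\<close>

text \<open>
  A transport of the cells of two finite partitions is refined to a coupling by taking coordinates
  independent within each pair of cells. Its density with respect to the product measure is
  \<open>w i j / (p i * r j)\<close> on the pair of cells \<open>i, j\<close> of measures \<open>p i\<close> and \<open>r j\<close>; if the denominator
  vanishes, then so does \<open>w i j\<close>.
\<close>

lemma exists_coupling_with_weights:
  fixes \<mu>1 \<mu>2 :: "'a::polish_space measure" and e1 :: "'a \<Rightarrow> 'i" and e2 :: "'a \<Rightarrow> 'j"
  assumes \<mu>: "borel_prob \<mu>1" "borel_prob \<mu>2"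
    and fin: "finite I" "finite J"
    and e: "\<And>x. e1 x \<in> I" "\<And>x. e2 x \<in> J"
    and m1: "\<And>i. i \<in> I \<Longrightarrow> {x. e1 x = i} \<in> sets borel"
    and m2: "\<And>j. j \<in> J \<Longrightarrow> {x. e2 x = j} \<in> sets borel"
    and w: "\<And>i j. i \<in> I \<Longrightarrow> j \<in> J \<Longrightarrow> 0 \<le> w i j"
    and w1: "\<And>i. i \<in> I \<Longrightarrow> (\<Sum>j\<in>J. w i j) = measure \<mu>1 {x. e1 x = i}"
    and w2: "\<And>j. j \<in> J \<Longrightarrow> (\<Sum>i\<in>I. w i j) = measure \<mu>2 {x. e2 x = j}"
  shows "\<exists>\<theta>\<in>couplings \<mu>1 \<mu>2. \<forall>i\<in>I. \<forall>j\<in>J. measure \<theta> {(x, y). e1 x = i \<and> e2 y = j} = w i j"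
proof -
  interpret p1: prob_space \<mu>1 using \<mu> by (simp add: borel_prob_def)
  interpret p2: prob_space \<mu>2 using \<mu> by (simp add: borel_prob_def)
  interpret pp: pair_prob_space \<mu>1 \<mu>2 ..
  have s[measurable_cong]: "sets \<mu>1 = sets borel" "sets \<mu>2 = sets borel"
    using \<mu> by (auto simp: borel_prob_def)
  have sp: "space \<mu>1 = UNIV" "space \<mu>2 = UNIV" using s[THEN sets_eq_imp_space_eq] by auto
  let ?P = "\<mu>1 \<Otimes>\<^sub>M \<mu>2"
  have sP: "sets ?P = sets borel" unfolding sets_pair_measure_cong[OF s] borel_prod ..
  define p where "p i = measure \<mu>1 {x. e1 x = i}" for i
  define r where "r j = measure \<mu>2 {x. e2 x = j}" for j
  have wp: "w i j = 0" if "i \<in> I" "j \<in> J" "p i = 0" for i j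
    using w1[OF that(1)] that w fin by (auto simp: p_def sum_nonneg_eq_0_iff)
  have wr: "w i j = 0" if "i \<in> I" "j \<in> J" "r j = 0" for i j
    using w2[OF that(2)] that w fin by (auto simp: r_def sum_nonneg_eq_0_iff)
  define c where "c i j = w i j / (p i * r j)" for i j
  have c0: "0 \<le> c i j" if "i \<in> I" "j \<in> J" for i j
    using w[OF that] by (simp add: c_def p_def r_def)
  have cp: "c i j * (p i * r j) = w i j" if "i \<in> I" "j \<in> J" for i j
    using wp[OF that] wr[OF that] by (auto simp: c_def)
  define R where "R i j = {x. e1 x = i} \<times> {y. e2 y = j}" for i j
  have R[measurable]: "R i j \<in> sets ?P" if "i \<in> I" "j \<in> J" for i j
    using m1[OF that(1)] m2[OF that(2)] unfolding R_def by (intro pair_measureI) (simp_all add: s)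
  define h where "h z = (\<Sum>i\<in>I. \<Sum>j\<in>J. ennreal (c i j) * indicator (R i j) z)" for z
  have h[measurable]: "h \<in> borel_measurable ?P"
    unfolding h_def[abs_def] by (intro borel_measurable_sum borel_measurable_times_ennreal) auto
  define \<theta> where "\<theta> = density ?P h"
  have rect: "emeasure \<theta> (A \<times> B) = ennreal (\<Sum>i\<in>I. \<Sum>j\<in>J.
      c i j * (measure \<mu>1 (A \<inter> {x. e1 x = i}) * measure \<mu>2 (B \<inter> {y. e2 y = j})))"
    if A: "A \<in> sets borel" and B: "B \<in> sets borel" for A B
  proof -
    have AB: "A \<times> B \<in> sets ?P" using A B by (intro pair_measureI) (simp_all add: s)
    have "emeasure \<theta> (A \<times> B) = (\<integral>\<^sup>+z. h z * indicator (A \<times> B) z \<partial>?P)"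
      unfolding \<theta>_def by (rule emeasure_density[OF h AB])
    also have "\<dots> = (\<integral>\<^sup>+z. (\<Sum>i\<in>I. \<Sum>j\<in>J. ennreal (c i j) *
        indicator ((A \<inter> {x. e1 x = i}) \<times> (B \<inter> {y. e2 y = j})) z) \<partial>?P)"
      unfolding h_def sum_distrib_right
      by (intro nn_integral_cong sum.cong refl) (auto simp: R_def indicator_def)
    also have "\<dots> = (\<Sum>i\<in>I. \<Sum>j\<in>J. \<integral>\<^sup>+z. ennreal (c i j) *
        indicator ((A \<inter> {x. e1 x = i}) \<times> (B \<inter> {y. e2 y = j})) z \<partial>?P)"
      using m1 m2 A B
      by (subst nn_integral_sum, (intro borel_measurable_sum)?)
        (auto intro!: sum.cong nn_integral_sum borel_measurable_times_ennreal
          borel_measurable_indicator pair_measureI simp: s)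
    also have "\<dots> = (\<Sum>i\<in>I. \<Sum>j\<in>J. ennreal (c i j *
        (measure \<mu>1 (A \<inter> {x. e1 x = i}) * measure \<mu>2 (B \<inter> {y. e2 y = j}))))"
    proof (intro sum.cong refl)
      fix i j assume ij: "i \<in> I" "j \<in> J"
      have a: "A \<inter> {x. e1 x = i} \<in> sets \<mu>1" "B \<inter> {y. e2 y = j} \<in> sets \<mu>2"
        using A B m1[OF ij(1)] m2[OF ij(2)] by (auto simp: s)
      then have "(A \<inter> {x. e1 x = i}) \<times> (B \<inter> {y. e2 y = j}) \<in> sets ?P" by (rule pair_measureI)
      then show "(\<integral>\<^sup>+z. ennreal (c i j) *
        indicator ((A \<inter> {x. e1 x = i}) \<times> (B \<inter> {y. e2 y = j})) z \<partial>?P) = ennreal (c i j *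
        (measure \<mu>1 (A \<inter> {x. e1 x = i}) * measure \<mu>2 (B \<inter> {y. e2 y = j})))"
        using c0[OF ij]
        by (simp add: nn_integral_cmult_indicator p2.emeasure_pair_measure_Times[OF a]
            p1.emeasure_eq_measure p2.emeasure_eq_measure ennreal_mult)
    qed
    also have "\<dots> = ennreal (\<Sum>i\<in>I. \<Sum>j\<in>J.
        c i j * (measure \<mu>1 (A \<inter> {x. e1 x = i}) * measure \<mu>2 (B \<inter> {y. e2 y = j})))"
      using c0 by (simp add: sum_nonneg)
    finally show ?thesis .
  qed
  have part1: "(\<Sum>i\<in>I. measure \<mu>1 (A \<inter> {x. e1 x = i})) = measure \<mu>1 A" if A: "A \<in> sets borel" for A
  proof -
    have "measure \<mu>1 A = measure \<mu>1 (\<Union>i\<in>I. A \<inter> {x. e1 x = i})"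
      using e by (intro arg_cong[where f="measure \<mu>1"]) auto
    also have "\<dots> = (\<Sum>i\<in>I. measure \<mu>1 (A \<inter> {x. e1 x = i}))"
      using A m1 by (intro p1.finite_measure_finite_Union fin) (auto simp: disjoint_family_on_def s)
    finally show ?thesis ..
  qed
  have part2: "(\<Sum>j\<in>J. measure \<mu>2 (B \<inter> {x. e2 x = j})) = measure \<mu>2 B" if B: "B \<in> sets borel" for B
  proof -
    have "measure \<mu>2 B = measure \<mu>2 (\<Union>j\<in>J. B \<inter> {x. e2 x = j})"
      using e by (intro arg_cong[where f="measure \<mu>2"]) auto
    also have "\<dots> = (\<Sum>j\<in>J. measure \<mu>2 (B \<inter> {x. e2 x = j}))"
      using B m2 by (intro p2.finite_measure_finite_Union fin) (auto simp: disjoint_family_on_def s)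
    finally show ?thesis ..
  qed
  have marg1: "emeasure \<theta> (A \<times> UNIV) = emeasure \<mu>1 A" if A: "A \<in> sets borel" for A
  proof -
    have "(\<Sum>j\<in>J. c i j * (measure \<mu>1 (A \<inter> {x. e1 x = i}) * r j)) = measure \<mu>1 (A \<inter> {x. e1 x = i})"
      if i: "i \<in> I" for i
    proof (cases "p i = 0")
      case True
      have "measure \<mu>1 (A \<inter> {x. e1 x = i}) \<le> p i"
        unfolding p_def using m1[OF i] by (intro p1.finite_measure_mono) (auto simp: s)
      then show ?thesis using True by (simp add: measure_le_0_iff)
    next
      case False
      have "(\<Sum>j\<in>J. c i j * (measure \<mu>1 (A \<inter> {x. e1 x = i}) * r j)) =
          (\<Sum>j\<in>J. w i j * (measure \<mu>1 (A \<inter> {x. e1 x = i}) / p i))"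
        using False by (intro sum.cong refl) (simp flip: cp[OF i])
      also have "\<dots> = p i * (measure \<mu>1 (A \<inter> {x. e1 x = i}) / p i)"
        unfolding sum_distrib_right[symmetric] w1[OF i] p_def ..
      finally show ?thesis using False by simp
    qed
    then show ?thesis
      using rect[OF A, of UNIV] part1[OF A] by (simp add: r_def p1.emeasure_eq_measure)
  qed
  have marg2: "emeasure \<theta> (UNIV \<times> B) = emeasure \<mu>2 B" if B: "B \<in> sets borel" for B
  proof -
    have "(\<Sum>i\<in>I. c i j * (p i * measure \<mu>2 (B \<inter> {x. e2 x = j}))) = measure \<mu>2 (B \<inter> {x. e2 x = j})"
      if j: "j \<in> J" for j
    proof (cases "r j = 0")
      case True
      have "measure \<mu>2 (B \<inter> {x. e2 x = j}) \<le> r j"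
        unfolding r_def using m2[OF j] by (intro p2.finite_measure_mono) (auto simp: s)
      then show ?thesis using True by (simp add: measure_le_0_iff)
    next
      case False
      have "(\<Sum>i\<in>I. c i j * (p i * measure \<mu>2 (B \<inter> {x. e2 x = j}))) =
          (\<Sum>i\<in>I. w i j * (measure \<mu>2 (B \<inter> {x. e2 x = j}) / r j))"
        using False by (intro sum.cong refl) (simp flip: cp[OF _ j])
      also have "\<dots> = r j * (measure \<mu>2 (B \<inter> {x. e2 x = j}) / r j)"
        unfolding sum_distrib_right[symmetric] w2[OF j] r_def ..
      finally show ?thesis using False by simp
    qed
    then have "(\<Sum>j\<in>J. \<Sum>i\<in>I. c i j * (p i * measure \<mu>2 (B \<inter> {x. e2 x = j}))) = measure \<mu>2 B"
      using part2[OF B] by simp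
    then have "(\<Sum>i\<in>I. \<Sum>j\<in>J. c i j * (p i * measure \<mu>2 (B \<inter> {x. e2 x = j}))) = measure \<mu>2 B"
      by (subst sum.swap)
    then show ?thesis
      using rect[OF _ B, of UNIV] by (simp add: p_def p2.emeasure_eq_measure)
  qed
  have s\<theta>: "sets \<theta> = sets borel" by (simp add: \<theta>_def sP)
  have sp\<theta>: "space \<theta> = UNIV" using sets_eq_imp_space_eq[OF s\<theta>] by simp
  have fs: "fst \<in> measurable \<theta> borel" "snd \<in> measurable \<theta> borel"
    unfolding measurable_cong_sets[OF s\<theta> refl]
    by (auto intro!: borel_measurable_continuous_onI continuous_intros)
  have "distr \<theta> borel fst = \<mu>1"
  proof (rule measure_eqI)
    fix A :: "'a set" assume "A \<in> sets (distr \<theta> borel fst)"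
    then show "emeasure (distr \<theta> borel fst) A = emeasure \<mu>1 A"
      using marg1[of A] by (simp add: emeasure_distr[OF fs(1)] sp\<theta> fst_vimage_eq_Times)
  qed (simp add: s)
  moreover have "distr \<theta> borel snd = \<mu>2"
  proof (rule measure_eqI)
    fix A :: "'a set" assume "A \<in> sets (distr \<theta> borel snd)"
    then show "emeasure (distr \<theta> borel snd) A = emeasure \<mu>2 A"
      using marg2[of A] by (simp add: emeasure_distr[OF fs(2)] sp\<theta> snd_vimage_eq_Times)
  qed (simp add: s)
  moreover have "prob_space \<theta>"
    using marg1[of UNIV] p1.emeasure_space_1 by (intro prob_spaceI) (simp add: sp\<theta> sp)
  ultimately have "\<theta> \<in> couplings \<mu>1 \<mu>2" by (simp add: couplings_def borel_prob_def s\<theta>)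
  moreover have "measure \<theta> {(x, y). e1 x = i \<and> e2 y = j} = w i j" if ij: "i \<in> I" "j \<in> J" for i j
  proof -
    have "measure \<mu>1 ({x. e1 x = i} \<inter> {x. e1 x = i'}) = (if i' = i then p i else 0)" for i'
    proof (cases "i' = i")
      case False
      then have "{x. e1 x = i} \<inter> {x. e1 x = i'} = {}" by auto
      with False show ?thesis by simp
    qed (simp add: p_def)
    moreover have "measure \<mu>2 ({y. e2 y = j} \<inter> {y. e2 y = j'}) = (if j' = j then r j else 0)" for j'
    proof (cases "j' = j")
      case False
      then have "{y. e2 y = j} \<inter> {y. e2 y = j'} = {}" by auto
      with False show ?thesis by simp
    qed (simp add: r_def)
    ultimately have "emeasure \<theta> ({x. e1 x = i} \<times> {y. e2 y = j}) = ennreal (\<Sum>i'\<in>I. \<Sum>j'\<in>J.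
        if j' = j then if i' = i then c i' j' * (p i * r j) else 0 else 0)"
      unfolding rect[OF m1[OF ij(1)] m2[OF ij(2)]]
      by (intro arg_cong[where f=ennreal] sum.cong refl) auto
    also have "\<dots> = ennreal (w i j)" using fin ij cp[OF ij] by simp
    also have "{x. e1 x = i} \<times> {y. e2 y = j} = {(x, y). e1 x = i \<and> e2 y = j}" by auto
    finally show ?thesis using w[OF ij] by (simp add: measure_def)
  qed
  ultimately show ?thesis by blast
qed

text \<open>
  Let \<open>U\<^sub>n\<close> be the union of the products of two of the first \<open>n\<close> basic balls that lie in \<open>U\<close>. Whether a pair
  belongs to \<open>U\<^sub>n\<close> depends only on its first \<open>n\<close> bits, so the finite theorem gives a coupling \<open>\<theta>\<^sub>n\<close> with
  \<open>\<theta>\<^sub>n(U\<^sub>n) \<le> s\<close>. As the \<open>U\<^sub>n\<close> increase, a limit \<open>\<theta>'\<close> of these couplings satisfies \<open>\<theta>'(U\<^sub>n) \<le> s\<close> for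
  every \<open>n\<close>, and their union is \<open>U\<close>.
\<close>

lemma strassen_open_set:
  fixes \<mu>1 \<mu>2 :: "'a::polish_space measure"
  assumes \<mu>: "borel_prob \<mu>1" "borel_prob \<mu>2"
    and U: "open U"
    and rect: "\<And>A D. A \<in> sets borel \<Longrightarrow> D \<in> sets borel \<Longrightarrow> A \<times> D \<subseteq> U \<Longrightarrow>
      measure \<mu>1 A + measure \<mu>2 D \<le> 1 + s"
  shows "\<exists>\<theta>\<in>couplings \<mu>1 \<mu>2. measure \<theta> U \<le> s"
proof -
  interpret p1: prob_space \<mu>1 using \<mu> by (simp add: borel_prob_def)
  interpret p2: prob_space \<mu>2 using \<mu> by (simp add: borel_prob_def)
  have s\<mu>: "sets \<mu>1 = sets borel" "sets \<mu>2 = sets borel"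
    using \<mu> by (auto simp: borel_prob_def)
  have sp: "space \<mu>1 = UNIV" "space \<mu>2 = UNIV" using s\<mu>[THEN sets_eq_imp_space_eq] by auto
  define bits where "bits n x = {k. k < n \<and> code x k}" for n and x :: 'a
  define V where "V S T \<longleftrightarrow> (\<exists>i\<in>S. \<exists>j\<in>T. base_ball i \<times> base_ball j \<subseteq> U)" for S T
  have code_k[measurable]: "Measurable.pred borel (\<lambda>x::'a. code x k)" for k
    using measurable_compose[OF code_measurable measurable_component_singleton[of k UNIV]] by simp
  have fs[measurable]: "fst \<in> borel_measurable (borel :: ('a \<times> 'a) measure)"
    "snd \<in> borel_measurable (borel :: ('a \<times> 'a) measure)"
    by (auto intro!: borel_measurable_continuous_onI continuous_intros)
  have bits1: "{x. Q (bits n x)} \<in> sets borel" for Q n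
    using finitely_many_bits_measurable[where P="\<lambda>k x. code x k" and M=borel
        and P'="\<lambda>k x. code x k" and Q="\<lambda>S T. Q S" and n=n] by (simp add: bits_def)
  have bits2: "{(x, y). Q (bits n x) (bits n y)} \<in> sets borel" for Q n
    using finitely_many_bits_measurable[where P="\<lambda>k z. code (fst z :: 'a) k" and M=borel
        and P'="\<lambda>k z. code (snd z :: 'a) k" and Q=Q and n=n] by (simp add: bits_def case_prod_unfold)
  have bitsP: "bits n x \<in> Pow {..<n}" for n x by (auto simp: bits_def)
  have VU: "(x, y) \<in> U" if V: "V (bits n x) (bits n y)" for n x y
    using V by (auto simp: V_def bits_def code_def)
  have "\<exists>\<theta>\<in>couplings \<mu>1 \<mu>2. measure \<theta> {(x, y). V (bits n x) (bits n y)} \<le> s" for n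
  proof -
    let ?I = "Pow {..<n}"
    define p where "p S = measure \<mu>1 {x. bits n x = S}" for S
    define r where "r S = measure \<mu>2 {x. bits n x = S}" for S
    have p: "sum p A = measure \<mu>1 {x. bits n x \<in> A}" and r: "sum r A = measure \<mu>2 {x. bits n x \<in> A}"
      if "A \<subseteq> ?I" for A
      using finite_subset[OF that]
        p1.measure_finite_fibres[of A "bits n"] p2.measure_finite_fibres[of A "bits n"] bits1
      by (auto simp: p_def r_def sp s\<mu>)
    have "\<exists>w. (\<forall>S\<in>?I. \<forall>T\<in>?I. 0 \<le> w S T) \<and> (\<forall>S\<in>?I. (\<Sum>T\<in>?I. w S T) = p S) \<and>
      (\<forall>T\<in>?I. (\<Sum>S\<in>?I. w S T) = r T) \<and> (\<Sum>S\<in>?I. \<Sum>T\<in>?I. if V S T then w S T else 0) \<le> s"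
    proof (rule finite_strassen)
      show "sum p ?I = 1" "sum r ?I = 1"
        using bitsP p[of ?I] r[of ?I] p1.prob_space p2.prob_space by (simp_all add: sp del: Pow_iff)
      fix A D assume A: "A \<subseteq> ?I" and D: "D \<subseteq> ?I" and AD: "\<And>S T. S \<in> A \<Longrightarrow> T \<in> D \<Longrightarrow> V S T"
      have "{x. bits n x \<in> A} \<times> {x. bits n x \<in> D} \<subseteq> U" using AD VU by blast
      then show "sum p A + sum r D \<le> 1 + s"
        unfolding p[OF A] r[OF D] by (intro rect bits1)
    qed (auto simp: p_def r_def)
    then obtain w where w: "\<And>S T. S \<in> ?I \<Longrightarrow> T \<in> ?I \<Longrightarrow> 0 \<le> w S T"
        "\<And>S. S \<in> ?I \<Longrightarrow> (\<Sum>T\<in>?I. w S T) = measure \<mu>1 {x. bits n x = S}"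
        "\<And>T. T \<in> ?I \<Longrightarrow> (\<Sum>S\<in>?I. w S T) = measure \<mu>2 {x. bits n x = T}"
      and ws: "(\<Sum>S\<in>?I. \<Sum>T\<in>?I. if V S T then w S T else 0) \<le> s"
      unfolding p_def r_def by blast
    obtain \<theta> where \<theta>: "\<theta> \<in> couplings \<mu>1 \<mu>2"
      and \<theta>w: "\<And>S T. S \<in> ?I \<Longrightarrow> T \<in> ?I \<Longrightarrow> measure \<theta> {(x, y). bits n x = S \<and> bits n y = T} = w S T"
      using exists_coupling_with_weights[of \<mu>1 \<mu>2 ?I ?I "bits n" "bits n" w,
          OF \<mu> _ _ bitsP bitsP bits1 bits1 w] by auto
    interpret \<theta>: prob_space \<theta> using \<theta> by (simp add: couplings_def borel_prob_def)
    have s\<theta>: "sets \<theta> = sets borel" using \<theta> by (simp add: couplings_def borel_prob_def)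
    have sp\<theta>: "space \<theta> = UNIV" using sets_eq_imp_space_eq[OF s\<theta>] by simp
    define B where "B = {(S, T) \<in> ?I \<times> ?I. V S T}"
    have B: "finite B" unfolding B_def by (rule finite_subset[of _ "?I \<times> ?I"]) auto
    have "{(x, y). V (bits n x) (bits n y)} = {z \<in> space \<theta>. (bits n (fst z), bits n (snd z)) \<in> B}"
      using bitsP by (auto simp: B_def sp\<theta> simp del: Pow_iff)
    also have "measure \<theta> \<dots> = (\<Sum>i\<in>B. measure \<theta> {z \<in> space \<theta>. (bits n (fst z), bits n (snd z)) = i})"
    proof (rule \<theta>.measure_finite_fibres[OF B])
      fix i show "{z \<in> space \<theta>. (bits n (fst z), bits n (snd z)) = i} \<in> sets \<theta>"
        using bits2[of "\<lambda>S T. (S, T) = i" n] by (simp add: s\<theta> sp\<theta> case_prod_unfold)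
    qed
    also have "\<dots> = (\<Sum>(S, T)\<in>B. w S T)"
    proof (intro sum.cong refl)
      fix i assume "i \<in> B"
      then obtain S T where i: "i = (S, T)" "S \<in> ?I" "T \<in> ?I" by (auto simp: B_def)
      show "measure \<theta> {z \<in> space \<theta>. (bits n (fst z), bits n (snd z)) = i} = (case i of (S, T) \<Rightarrow> w S T)"
        using \<theta>w[OF i(2,3)] by (simp add: i(1) sp\<theta> case_prod_unfold)
    qed
    also have "\<dots> = (\<Sum>(S, T)\<in>?I \<times> ?I. if V S T then w S T else 0)"
      unfolding B_def by (intro sum.mono_neutral_cong_left) (auto split: if_splits)
    also have "\<dots> \<le> s" using ws by (simp add: sum.cartesian_product)
    finally show ?thesis using \<theta> by blast
  qed
  then obtain \<theta> where \<theta>: "\<And>n. \<theta> n \<in> couplings \<mu>1 \<mu>2"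
    and \<theta>s: "\<And>n. measure (\<theta> n) {(x, y). V (bits n x) (bits n y)} \<le> s"
    by metis
  obtain \<theta>' and \<phi> :: "nat \<Rightarrow> nat" where \<theta>': "\<theta>' \<in> couplings \<mu>1 \<mu>2" and \<phi>: "strict_mono \<phi>"
    and lim: "\<And>n Q. (\<lambda>m. measure (\<theta> (\<phi> m)) {(x, y). Q (bits n x) (bits n y)})
      \<longlonglongrightarrow> measure \<theta>' {(x, y). Q (bits n x) (bits n y)}"
    using couplings_limit[of \<mu>1 \<mu>2 \<theta>, OF \<mu> \<theta>] unfolding bits_def by blast
  interpret \<theta>': prob_space \<theta>' using \<theta>' by (simp add: couplings_def borel_prob_def)
  have mono: "{(x, y). V (bits n x) (bits n y)} \<subseteq> {(x, y). V (bits m x) (bits m y)}" if "n \<le> m" for n m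
  proof -
    have "bits n x \<subseteq> bits m x" for x using that by (auto simp: bits_def)
    then show ?thesis unfolding V_def by blast
  qed
  have "measure \<theta>' {(x, y). V (bits n x) (bits n y)} \<le> s" for n
  proof (rule LIMSEQ_le_const2[OF lim])
    have "measure (\<theta> (\<phi> m)) {(x, y). V (bits n x) (bits n y)} \<le> s" if "n \<le> m" for m
    proof -
      interpret \<theta>: prob_space "\<theta> (\<phi> m)" using \<theta>[of "\<phi> m"] by (simp add: couplings_def borel_prob_def)
      have "n \<le> \<phi> m" using that seq_suble[OF \<phi>, of m] by simp
      then have "measure (\<theta> (\<phi> m)) {(x, y). V (bits n x) (bits n y)} \<le>
          measure (\<theta> (\<phi> m)) {(x, y). V (bits (\<phi> m) x) (bits (\<phi> m) y)}"
        using \<theta>[of "\<phi> m"] bits2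
        by (intro \<theta>.finite_measure_mono mono) (auto simp: couplings_def borel_prob_def)
      then show ?thesis using \<theta>s[of "\<phi> m"] by simp
    qed
    then show "\<exists>N. \<forall>m\<ge>N. measure (\<theta> (\<phi> m)) {(x, y). V (bits n x) (bits n y)} \<le> s" by blast
  qed
  moreover have "(\<lambda>n. measure \<theta>' {(x, y). V (bits n x) (bits n y)})
      \<longlonglongrightarrow> measure \<theta>' (\<Union>n. {(x, y). V (bits n x) (bits n y)})"
    using \<theta>' bits2 mono
    by (intro \<theta>'.finite_Lim_measure_incseq) (auto simp: couplings_def borel_prob_def incseq_def)
  ultimately have "measure \<theta>' (\<Union>n. {(x, y). V (bits n x) (bits n y)}) \<le> s"
    by (intro LIMSEQ_le_const2) auto
  moreover have "U \<subseteq> (\<Union>n. {(x, y). V (bits n x) (bits n y)})"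
  proof
    fix z assume "z \<in> U"
    then obtain A B where AB0: "open A" "open B" "z \<in> A \<times> B" "A \<times> B \<subseteq> U"
      by (rule open_prod_elim[OF U])
    then obtain x y where z: "z = (x, y)" and AB: "open A" "open B" "x \<in> A" "y \<in> B" "A \<times> B \<subseteq> U"
      by (cases z) auto
    obtain i j where i: "x \<in> base_ball i" "base_ball i \<subseteq> A" and j: "y \<in> base_ball j" "base_ball j \<subseteq> B"
      using base_ball_basis[OF AB(1,3)] base_ball_basis[OF AB(2,4)] by blast
    have "base_ball i \<times> base_ball j \<subseteq> U" using i(2) j(2) AB(5) by blast
    then have "V (bits (Suc (max i j)) x) (bits (Suc (max i j)) y)"
      unfolding V_def using i(1) j(1)
      by (intro bexI[of _ i] bexI[of _ j]) (auto simp: bits_def code_def)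
    then show "z \<in> (\<Union>n. {(x, y). V (bits n x) (bits n y)})" using z by blast
  qed
  then have "U = (\<Union>n. {(x, y). V (bits n x) (bits n y)})" using VU by blast
  ultimately show ?thesis using \<theta>' by auto
qed

section \<open>Lipschitz classifiers from separated sets\<close>

text \<open>
  Lower semi-continuity and the tube lemma. The infimum of \<open>d x\<close> over a set is in general not
  measurable in \<open>x\<close>; over a compact set it is lower semi-continuous, so countable unions of compact
  sets are the right sets to measure the distance from.
\<close>

lemma open_far_from_compact:
  fixes d :: "'a::polish_space \<Rightarrow> 'a \<Rightarrow> real"
  assumes d: "lsc_metric d" and L: "compact L"
  shows "open {x. \<forall>y\<in>L. c < d x y}"
proof (rule Topological_Spaces.openI)
  fix x assume "x \<in> {x. \<forall>y\<in>L. c < d x y}"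
  then have "{x} \<times> L \<subseteq> {z. c < (case z of (x, y) \<Rightarrow> d x y)}" by auto
  moreover have "open {z. c < (case z of (x, y) \<Rightarrow> d x y)}"
    using d by (auto simp: lsc_metric_def lower_semicont_def)
  ultimately have "\<exists>T. x \<in> T \<and> open T \<and> T \<times> L \<subseteq> {z. c < (case z of (x, y) \<Rightarrow> d x y)}"
    by (intro Elementary_Topology.tube_lemma[OF L])
  then obtain T where "x \<in> T" "open T" "T \<times> L \<subseteq> {z. c < (case z of (x, y) \<Rightarrow> d x y)}"
    by (elim exE conjE)
  then show "\<exists>T. open T \<and> x \<in> T \<and> T \<subseteq> {x. \<forall>y\<in>L. c < d x y}"
    by (intro exI[of _ T]) auto
qed

lemma truncated_distance_measurable:
  fixes d :: "'a::polish_space \<Rightarrow> 'a \<Rightarrow> real"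
  assumes d: "lsc_metric d" and L: "\<And>n::nat. compact (L n)"
  shows "(\<lambda>x. Inf (insert R (d x ` (\<Union>n. L n)))) \<in> borel_measurable borel"
  unfolding borel_measurable_iff_ge
proof
  fix c
  interpret m: Metric_space UNIV d using d by (simp add: lsc_metric_def)
  have bdd: "bdd_below (insert R (d x ` (\<Union>n. L n)))" for x
    by (auto intro!: bdd_belowI[of _ 0])
  have "c \<le> Inf (insert R (d x ` (\<Union>n. L n))) \<longleftrightarrow>
      c \<le> R \<and> (\<forall>n k. \<forall>y\<in>L n. c - 1 / real (Suc k) < d x y)" for x
  proof -
    have arch: "c \<le> t \<longleftrightarrow> (\<forall>k. c - 1 / real (Suc k) < t)" for t :: real
    proof
      assume small: "\<forall>k. c - 1 / real (Suc k) < t"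
      show "c \<le> t"
      proof (rule ccontr)
        assume "\<not> c \<le> t"
        then obtain k where "inverse (real (Suc k)) < c - t" using reals_Archimedean[of "c - t"] by auto
        then show False using small[rule_format, of k] by (simp add: inverse_eq_divide)
      qed
    next
      assume "c \<le> t"
      show "\<forall>k. c - 1 / real (Suc k) < t"
      proof
        fix k
        have "0 < 1 / real (Suc k)" by simp
        then show "c - 1 / real (Suc k) < t" using \<open>c \<le> t\<close> by linarith
      qed
    qed
    have "c \<le> Inf (insert R (d x ` (\<Union>n. L n))) \<longleftrightarrow> c \<le> R \<and> (\<forall>n. \<forall>y\<in>L n. c \<le> d x y)"
      by (subst le_cInf_iff[OF _ bdd]) auto
    then show ?thesis unfolding arch[of "d x _"] by blast
  qed
  then have "{x \<in> space borel. c \<le> Inf (insert R (d x ` (\<Union>n. L n)))} =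
      (if c \<le> R then (\<Inter>n. \<Inter>k. {x. \<forall>y\<in>L n. c - 1 / real (Suc k) < d x y}) else {})"
    by auto
  also have "\<dots> \<in> sets borel"
    using open_far_from_compact[OF d L] by (auto intro!: sets.countable_INT'')
  finally show "{x \<in> space borel. c \<le> Inf (insert R (d x ` (\<Union>n. L n)))} \<in> sets borel" .
qed

text \<open>
  The classification function is the distance to \<open>\<Union>n. L n\<close>, cut off at \<open>R\<close> and shifted by \<open>r / 2\<close>: it is at
  most \<open>- r / 2\<close> on that union and equal to \<open>R - r / 2 > r / 2\<close> on \<open>A\<close>. The cut-off makes it
  bounded, hence integrable, and gives the infimum a meaning when the union is empty.
\<close>

lemma classifier_of_separated_sets:
  fixes d :: "'a::polish_space \<Rightarrow> 'a \<Rightarrow> real"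
  assumes d: "lsc_metric d" and \<mu>: "borel_prob \<mu>1" "borel_prob \<mu>2"
    and A: "A \<in> sets borel" and L: "\<And>n::nat. compact (L n)"
    and far: "\<And>x y. x \<in> A \<Longrightarrow> y \<in> (\<Union>n. L n) \<Longrightarrow> R \<le> d x y"
    and r: "0 \<le> r" "r < R"
  shows "\<exists>f. lipschitz_classifier d \<mu>1 \<mu>2 r
    (2 - measure \<mu>1 A - measure \<mu>2 (\<Union>n. L n)) (classifier f) f"
proof -
  interpret m: Metric_space UNIV d using d by (simp add: lsc_metric_def)
  interpret p1: prob_space \<mu>1 using \<mu> by (simp add: borel_prob_def)
  interpret p2: prob_space \<mu>2 using \<mu> by (simp add: borel_prob_def)
  have s: "sets \<mu>1 = sets borel" "sets \<mu>2 = sets borel" using \<mu> by (auto simp: borel_prob_def)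
  have sp: "space \<mu>1 = UNIV" "space \<mu>2 = UNIV" using s[THEN sets_eq_imp_space_eq] by auto
  define D where "D = (\<Union>n. L n)"
  have D: "D \<in> sets borel"
    unfolding D_def using L by (intro sets.countable_UN) (auto intro: borel_compact)
  define g where "g x = Inf (insert R (d x ` D))" for x
  have bdd: "bdd_below (insert R (d x ` D))" for x
    using r by (auto intro!: bdd_belowI[of _ 0])
  have le: "c \<le> g x \<longleftrightarrow> c \<le> R \<and> (\<forall>y\<in>D. c \<le> d x y)" for c x
    unfolding g_def by (subst le_cInf_iff[OF _ bdd]) auto
  have gD: "g y \<le> 0" if "y \<in> D" for y
    using le[of "g y" y] that by auto
  have g0: "0 \<le> g x" "g x \<le> R" for x using le[of 0 x] le[of "g x" x] r by auto
  have gA: "R \<le> g x" if "x \<in> A" for x using le[of R x] far that by (auto simp: D_def)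
  have "g x - d x y \<le> g y" for x y
    unfolding le[of _ y]
  proof (intro conjI ballI)
    show "g x - d x y \<le> R" using g0(2)[of x] m.nonneg[of x y] by linarith
    fix z assume "z \<in> D"
    then have "g x \<le> d x z" using le[of "g x" x] by simp
    also have "\<dots> \<le> d x y + d y z" by (rule m.triangle) auto
    finally show "g x - d x y \<le> d y z" by simp
  qed
  then have lip: "\<bar>g x - g y\<bar> \<le> d x y" for x y
    using m.commute[of x y] by (smt (verit))
  have g[measurable]: "g \<in> borel_measurable borel"
    unfolding g_def[abs_def] D_def by (rule truncated_distance_measurable[OF d L])
  define f where "f x = g x - r / 2" for x
  have f: "f \<in> borel_measurable borel" unfolding f_def[abs_def] by measurable
  have f1: "f \<in> borel_measurable \<mu>1" and f2: "f \<in> borel_measurable \<mu>2"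
    using f s measurable_cong_sets by blast+
  have fb: "norm (f x) \<le> R" for x using g0[of x] r by (auto simp: f_def)
  have "measure \<mu>1 {x. f x \<le> r / 2} \<le> measure \<mu>1 (space \<mu>1 - A)"
    using gA r A by (intro p1.finite_measure_mono) (force simp: f_def sp s)+
  moreover have "measure \<mu>2 {x. f x > - r / 2} \<le> measure \<mu>2 (space \<mu>2 - D)"
    using gD D by (intro p2.finite_measure_mono) (force simp: f_def sp s)+
  ultimately have "margin_error f r \<mu>1 \<mu>2 \<le> 2 - measure \<mu>1 A - measure \<mu>2 D"
    using A D by (simp add: margin_error_def p1.prob_compl p2.prob_compl s)
  then have "lipschitz_classifier d \<mu>1 \<mu>2 r (2 - measure \<mu>1 A - measure \<mu>2 D) (classifier f) f"
    using f lip p1.integrable_const_bound[OF _ f1, of R] p2.integrable_const_bound[OF _ f2, of R] fb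
    by (simp add: lipschitz_classifier_def f_def err_def min_le_iff_disj)
  then show ?thesis unfolding D_def by blast
qed

section \<open>Separated sets from the transport distance\<close>

lemma inner_regular_prob:
  fixes M :: "'a::polish_space measure"
  assumes M: "borel_prob M" and A: "A \<in> sets borel" and e: "0 < e"
  shows "\<exists>K\<subseteq>A. compact K \<and> measure M A - e < measure M K"
proof -
  interpret prob_space M using M by (simp add: borel_prob_def)
  have s: "sets M = sets borel" using M by (simp add: borel_prob_def)
  show ?thesis
  proof (cases "measure M A - e < 0")
    case True
    then show ?thesis by (intro exI[of _ "{}"]) auto
  next
    case False
    have "ennreal (measure M A - e) < emeasure M A"
      using e False by (simp add: emeasure_eq_measure ennreal_less_iff)
    also have "emeasure M A = (SUP K\<in>{K. K \<subseteq> A \<and> compact K}. emeasure M K)"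
      by (rule inner_regular[OF s _ A]) simp
    finally obtain K where "K \<subseteq> A" "compact K" "ennreal (measure M A - e) < emeasure M K"
      by (auto simp: less_SUP_iff)
    then show ?thesis using False by (auto simp: emeasure_eq_measure ennreal_less_iff)
  qed
qed

lemma metric_le_diam:
  fixes d :: "'a::polish_space \<Rightarrow> 'a \<Rightarrow> real"
  assumes "lsc_metric d" "Metric_space.mbounded UNIV d UNIV"
  shows "d x y \<le> diam d"
proof -
  interpret m: Metric_space UNIV d using assms(1) by (simp add: lsc_metric_def)
  obtain B where "\<And>x y. d x y \<le> B" using assms(2) by (auto simp: m.mbounded_alt)
  then have "bdd_above (range (\<lambda>(x, y). d x y))" by (auto intro!: bdd_aboveI[of _ B])
  from cSUP_upper[OF _ this, of "(x, y)"] show ?thesis by (simp add: diam_def)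
qed

text \<open>
  If no such sets existed, then by inner regularity no rectangle of pairs at distance more than
  \<open>\<kappa> * diam d\<close> would have large measure, and Strassen's theorem would give a coupling that moves a mass
  of at most \<open>1 - b\<close> by more than \<open>\<kappa> * diam d\<close>, which is cheaper than the transport distance permits.
\<close>

lemma exists_far_compacts:
  fixes d :: "'a::polish_space \<Rightarrow> 'a \<Rightarrow> real"
  assumes d: "lsc_metric d" "Metric_space.mbounded UNIV d UNIV" "diam d > 0"
    and \<mu>: "borel_prob \<mu>1" "borel_prob \<mu>2"
    and \<kappa>: "0 \<le> \<kappa>" "\<kappa> < 1"
    and b: "1 - enn2real (wasserstein d \<mu>1 \<mu>2) / diam d < (1 - \<kappa>) * b"
  shows "\<exists>K L. compact K \<and> compact L \<and> (\<forall>x\<in>K. \<forall>y\<in>L. \<kappa> * diam d < d x y) \<and>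
    2 - b \<le> measure \<mu>1 K + measure \<mu>2 L"
proof (rule ccontr)
  assume "\<not> ?thesis"
  then have few: "measure \<mu>1 K + measure \<mu>2 L \<le> 2 - b"
    if "compact K" "compact L" "\<And>x y. x \<in> K \<Longrightarrow> y \<in> L \<Longrightarrow> \<kappa> * diam d < d x y" for K L
    using that by (meson le_cases)
  define \<Delta> where "\<Delta> = diam d"
  define U where "U = {z. \<kappa> * \<Delta> < (case z of (x, y) \<Rightarrow> d x y)}"
  have U: "open U" using d(1) by (simp add: U_def lsc_metric_def lower_semicont_def)
  have "\<exists>\<theta>\<in>couplings \<mu>1 \<mu>2. measure \<theta> U \<le> 1 - b"
  proof (rule strassen_open_set[OF \<mu> U])
    fix A D :: "'a set"
    assume A: "A \<in> sets borel" and D: "D \<in> sets borel" and AD: "A \<times> D \<subseteq> U"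
    have "measure \<mu>1 A + measure \<mu>2 D \<le> 1 + (1 - b) + e" if "e > 0" for e
    proof -
      have e: "e / 2 > 0" using that by simp
      obtain K where K: "K \<subseteq> A" "compact K" "measure \<mu>1 A - e / 2 < measure \<mu>1 K"
        using inner_regular_prob[OF \<mu>(1) A e] by blast
      obtain L where L: "L \<subseteq> D" "compact L" "measure \<mu>2 D - e / 2 < measure \<mu>2 L"
        using inner_regular_prob[OF \<mu>(2) D e] by blast
      have "\<kappa> * diam d < d x y" if "x \<in> K" "y \<in> L" for x y
      proof -
        have "(x, y) \<in> U" using that K(1) L(1) AD by blast
        then show ?thesis by (simp add: U_def \<Delta>_def)
      qed
      from few[OF K(2) L(2) this] show ?thesis using K(3) L(3) by simp
    qed
    then show "measure \<mu>1 A + measure \<mu>2 D \<le> 1 + (1 - b)"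
      by (rule field_le_epsilon)
  qed
  then obtain \<theta> where \<theta>: "\<theta> \<in> couplings \<mu>1 \<mu>2" and \<theta>U: "measure \<theta> U \<le> 1 - b" by blast
  interpret \<theta>: prob_space \<theta> using \<theta> by (simp add: couplings_def borel_prob_def)
  have s: "sets \<theta> = sets borel" using \<theta> by (simp add: couplings_def borel_prob_def)
  have U_s: "U \<in> sets \<theta>" using U by (simp add: s)
  have k: "0 \<le> \<kappa> * \<Delta>" "0 \<le> (1 - \<kappa>) * \<Delta>" using \<kappa> d(3) by (auto simp: \<Delta>_def)
  have "wasserstein d \<mu>1 \<mu>2 \<le> (\<integral>\<^sup>+ (x, y). ennreal (d x y) \<partial>\<theta>)"
    unfolding wasserstein_def using \<theta> by (rule INF_lower)
  also have "\<dots> \<le> (\<integral>\<^sup>+ z. ennreal (\<kappa> * \<Delta>) + ennreal ((1 - \<kappa>) * \<Delta>) * indicator U z \<partial>\<theta>)"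
  proof (rule nn_integral_mono)
    fix z :: "'a \<times> 'a"
    obtain x y where z: "z = (x, y)" by (cases z)
    show "(case z of (x, y) \<Rightarrow> ennreal (d x y)) \<le>
        ennreal (\<kappa> * \<Delta>) + ennreal ((1 - \<kappa>) * \<Delta>) * indicator U z"
    proof (cases "z \<in> U")
      case True
      have "ennreal (d x y) \<le> ennreal (\<kappa> * \<Delta> + (1 - \<kappa>) * \<Delta>)"
        using metric_le_diam[OF d(1,2), of x y] by (intro ennreal_leI) (simp add: \<Delta>_def algebra_simps)
      then show ?thesis using True k by (simp add: z)
    next
      case False
      then show ?thesis by (auto simp: z U_def intro!: ennreal_leI)
    qed
  qed
  also have "\<dots> = ennreal (\<kappa> * \<Delta> + (1 - \<kappa>) * \<Delta> * measure \<theta> U)"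
    using U_s k
    by (simp add: nn_integral_add nn_integral_cmult_indicator
        \<theta>.emeasure_eq_measure \<theta>.prob_space ennreal_mult)
  finally have "enn2real (wasserstein d \<mu>1 \<mu>2) \<le> \<kappa> * \<Delta> + (1 - \<kappa>) * \<Delta> * measure \<theta> U"
    using k by (intro enn2real_leI) auto
  also have "\<dots> \<le> \<kappa> * \<Delta> + (1 - \<kappa>) * \<Delta> * (1 - b)"
    using \<theta>U k by (intro add_left_mono mult_left_mono) auto
  also have "\<dots> = (1 - (1 - \<kappa>) * b) * \<Delta>" by (simp add: algebra_simps)
  finally have "enn2real (wasserstein d \<mu>1 \<mu>2) / \<Delta> \<le> 1 - (1 - \<kappa>) * b"
    using d(3) by (simp add: \<Delta>_def divide_le_eq)
  then show False using b by (simp add: \<Delta>_def)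
qed

text \<open>
  The complements have summable probabilities, so Borel-Cantelli applies.
\<close>

lemma (in prob_space) prob_eventually_eq_1:
  assumes K: "\<And>n. K n \<in> events" and big: "\<And>n. 1 - (1 / 2) ^ n \<le> prob (K n)"
  shows "prob (\<Union>N. \<Inter>n\<in>{N..}. K n) = 1"
proof -
  have "(\<Union>N. \<Inter>n\<in>{N..}. K n) \<in> events" using K by (intro sets.countable_UN sets.countable_INT'') auto
  moreover have "AE x in M. eventually (\<lambda>n. x \<in> space M - (space M - K n)) sequentially"
  proof (rule borel_cantelli_AE1)
    show "summable (\<lambda>n. prob (space M - K n))"
    proof (rule summable_comparison_test')
      show "summable (\<lambda>n. (1 / 2 :: real) ^ n)" by (rule summable_geometric) simp
      show "norm (prob (space M - K n)) \<le> (1 / 2) ^ n" if "0 \<le> n" for n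
        using big[of n] by (simp add: prob_compl[OF K])
    qed
  qed (use K in \<open>auto simp: less_top[symmetric]\<close>)
  then have "AE x in M. x \<in> (\<Union>N. \<Inter>n\<in>{N..}. K n)"
    by eventually_elim (auto simp: eventually_sequentially)
  ultimately show ?thesis by (simp add: prob_eq_1)
qed

theorem theorem6p2p6:
  fixes d :: "'a::polish_space \<Rightarrow> 'a \<Rightarrow> real"
    and \<mu>1 \<mu>2 :: "'a measure"
    and \<rho> :: real
  assumes "lsc_metric d"
    and "Metric_space.mbounded UNIV d UNIV"
    and "diam d > 0"
    and "borel_prob \<mu>1" and "borel_prob \<mu>2"
    and "0 \<le> \<rho>" and "\<rho> < 1"
  shows "\<exists>\<delta>\<ge>0. \<exists>c f.
           lipschitz_classifier d \<mu>1 \<mu>2 (\<rho> * diam d) \<delta> c f \<and>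
           \<delta> \<le> 2 / (1 - \<rho>) * (1 - enn2real (wasserstein d \<mu>1 \<mu>2) / diam d)"
proof -
  interpret p1: prob_space \<mu>1 using assms by (simp add: borel_prob_def)
  interpret p2: prob_space \<mu>2 using assms by (simp add: borel_prob_def)
  have s: "sets \<mu>1 = sets borel" "sets \<mu>2 = sets borel" using assms by (auto simp: borel_prob_def)
  define W where "W = enn2real (wasserstein d \<mu>1 \<mu>2)"
  define \<Delta> where "\<Delta> = diam d"
  \<comment> \<open>Any \<open>\<kappa>\<close> strictly between \<open>\<rho>\<close> and \<open>(1 + \<rho>) / 2\<close> would do: the lower bound keeps a positive distance
     beyond the margin, the upper bound says that \<open>2 / (1 - \<rho>)\<close> exceeds \<open>1 / (1 - \<kappa>)\<close>.\<close>
  define \<kappa> where "\<kappa> = (1 + 3 * \<rho>) / 4"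
  have \<Delta>: "0 < \<Delta>" using assms by (simp add: \<Delta>_def)
  have \<kappa>: "0 \<le> \<kappa>" "\<kappa> < 1" "\<rho> < \<kappa>" using assms by (auto simp: \<kappa>_def)
  have r: "0 \<le> \<rho> * \<Delta>" "\<rho> * \<Delta> < \<kappa> * \<Delta>" using assms \<kappa> \<Delta> by auto
  have far: "\<exists>K L. compact K \<and> compact L \<and> (\<forall>x\<in>K. \<forall>y\<in>L. \<kappa> * \<Delta> < d x y) \<and>
      2 - b \<le> measure \<mu>1 K + measure \<mu>2 L" if "1 - W / \<Delta> < (1 - \<kappa>) * b" for b
    unfolding \<Delta>_def using that by (intro exists_far_compacts assms \<kappa>) (simp add: W_def \<Delta>_def)
  have "W \<le> \<Delta>"
    using wasserstein_le_diam[OF assms(1,2,4,5)] \<Delta> by (auto simp: W_def \<Delta>_def intro!: enn2real_leI)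
  then consider (less) "W < \<Delta>" | (eq) "W = \<Delta>" by force
  then show ?thesis
  proof cases
    case less
    define b where "b = 2 / (1 - \<rho>) * (1 - W / \<Delta>)"
    have gap: "0 < 1 - W / \<Delta>" using less \<Delta> by simp
    have "(1 - \<kappa>) * b = 3 / 2 * (1 - W / \<Delta>)"
      using assms by (simp add: b_def \<kappa>_def field_simps)
    then have "1 - W / \<Delta> < (1 - \<kappa>) * b" using gap by simp
    from far[OF this] obtain K L where K: "compact K" and L: "compact L"
      and KL: "\<And>x y. x \<in> K \<Longrightarrow> y \<in> L \<Longrightarrow> \<kappa> * \<Delta> < d x y"
      and big: "2 - b \<le> measure \<mu>1 K + measure \<mu>2 L" by blast
    obtain f where "lipschitz_classifier d \<mu>1 \<mu>2 (\<rho> * \<Delta>) (2 - measure \<mu>1 K - measure \<mu>2 L) (classifier f) f"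
      using classifier_of_separated_sets[where L="\<lambda>_. L", OF assms(1,4,5) borel_compact[OF K] L
          less_imp_le[OF KL] r] by auto
    then have "lipschitz_classifier d \<mu>1 \<mu>2 (\<rho> * \<Delta>) b (classifier f) f"
      using big by (auto simp: lipschitz_classifier_def)
    moreover have "0 \<le> b" using gap assms by (simp add: b_def)
    ultimately show ?thesis unfolding b_def W_def \<Delta>_def by (metis order_refl)
  next
    case eq
    have "1 - W / \<Delta> < (1 - \<kappa>) * (1 / 2) ^ n" for n using eq \<Delta> \<kappa> by simp
    from far[OF this] have "\<forall>n. \<exists>K L. compact K \<and> compact L \<and> (\<forall>x\<in>K. \<forall>y\<in>L. \<kappa> * \<Delta> < d x y) \<and>
      2 - (1 / 2) ^ n \<le> measure \<mu>1 K + measure \<mu>2 L" by (rule allI)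
    then obtain K L where K: "\<And>n. compact (K n)" and L: "\<And>n. compact (L n)"
      and KL: "\<And>n x y. x \<in> K n \<Longrightarrow> y \<in> L n \<Longrightarrow> \<kappa> * \<Delta> < d x y"
      and big: "\<And>n. 2 - (1 / 2) ^ n \<le> measure \<mu>1 (K n) + measure \<mu>2 (L n)" by metis
    define A where "A = (\<Union>N. \<Inter>n\<in>{N..}. K n)"
    have "1 - (1 / 2) ^ n \<le> measure \<mu>1 (K n)" "1 - (1 / 2) ^ n \<le> measure \<mu>2 (L n)" for n
      using big[of n] p1.prob_le_1[of "K n"] p2.prob_le_1[of "L n"] by linarith+
    then have full: "measure \<mu>1 A = 1" "measure \<mu>2 (\<Union>N. \<Inter>n\<in>{N..}. L n) = 1"
      unfolding A_def
      by (intro p1.prob_eventually_eq_1 p2.prob_eventually_eq_1; simp add: s borel_compact K L)+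
    have A: "A \<in> sets borel"
      unfolding A_def using K by (intro sets.countable_UN sets.countable_INT'') (auto intro: borel_compact)
    have "compact (L N \<inter> (\<Inter>n\<in>{N..}. L n))" for N
      using L by (intro compact_Int_closed closed_INT) (auto intro: compact_imp_closed)
    moreover have "L N \<inter> (\<Inter>n\<in>{N..}. L n) = (\<Inter>n\<in>{N..}. L n)" for N by auto
    ultimately have cpt: "compact (\<Inter>n\<in>{N..}. L n)" for N by simp
    have "\<kappa> * \<Delta> \<le> d x y" if x: "x \<in> A" and y: "y \<in> (\<Union>N. \<Inter>n\<in>{N..}. L n)" for x y
    proof -
      obtain N M where "\<And>n. n \<ge> N \<Longrightarrow> x \<in> K n" "\<And>n. n \<ge> M \<Longrightarrow> y \<in> L n"
        using x y by (auto simp: A_def)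
      then show ?thesis using KL[of x "max N M" y] by simp
    qed
    from classifier_of_separated_sets[where L="\<lambda>N. \<Inter>n\<in>{N..}. L n", OF assms(1,4,5) A cpt this r]
    obtain f where "lipschitz_classifier d \<mu>1 \<mu>2 (\<rho> * \<Delta>) 0 (classifier f) f"
      unfolding full by auto
    moreover have "0 = 2 / (1 - \<rho>) * (1 - W / \<Delta>)" using eq \<Delta> by simp
    ultimately show ?thesis unfolding W_def \<Delta>_def by (metis order_refl)
  qed
qed

end
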